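(* Let $G$ be a noncompact minimally weakly almost periodic locally compact group. Then $WS(G)=AP(G)$.
   Context: For a locally compact group $G$, $C(G)$ is the $C^*$-algebra of bounded continuous complex-valued functions on $G$ with the sup norm and $C_0(G)$ is the subalgebra of functions vanishing at infinity. For $f\in C(G)$ and $x,y\in G$ put ${}_xf(z)=f(xz)$ and ${}_xf_y(z)=f(xzy)$; $O_L(f)=\{{}_xf:x\in G\}$ is the left orbit and $O(f)=\{{}_xf_y:x,y\in G\}$ the double orbit. $AP(G)$ (resp. $WAP(G)$) is the set of $f\in C(G)$ such that $O_L(f)$ is relatively norm compact (resp. relatively weakly compact) in $C(G)$. $WS(G)$ is the set of $f\in C(G)$ such that $O(f)$ is relatively weakly compact in $C(G)$. A noncompact locally compact group $G$ is minimally weakly almost periodic if $WAP(G)=AP(G)\oplus C_0(G)$. *)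

theory Defs
  imports "HOL-Analysis.Analysis"
begin

text \<open>
  Topological groups are types of class \<^class>\<open>topological_group_add\<close>; this class does not
  assume commutativity, so the product \<open>x y\<close> of the group is written \<open>x + y\<close> here and the
  order of the summands matters. The algebra \<open>C(G)\<close> of bounded continuous complex functions
  with the sup norm is the library type \<^typ>\<open>'a \<Rightarrow>\<^sub>C complex\<close>.
\<close>

subsection \<open>The weak topology of C(G)\<close>

text \<open>
  The library only equips bounded continuous functions with a real vector space structure, so
  multiplication by complex scalars is added in order to speak about complex functionals.
\<close>

unbundle bcontfun.lifting

lift_definition cscale_bcontfun ::
    "complex \<Rightarrow> ('a::topological_space \<Rightarrow>\<^sub>C complex) \<Rightarrow> ('a \<Rightarrow>\<^sub>C complex)"
  is "\<lambda>c f z. c * f z"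
proof -
  fix c :: complex and f :: "'a \<Rightarrow> complex"
  assume "f \<in> bcontfun"
  then have "continuous_on UNIV f" and "bounded ((\<lambda>w. c * w) ` range f)"
    by (simp_all add: bcontfun_def bounded_linear_image[OF _ bounded_linear_mult_right])
  then show "(\<lambda>z. c * f z) \<in> bcontfun"
    by (simp add: bcontfun_def image_image continuous_on_mult_left)
qed

definition dual_bcontfun :: "(('a::topological_space \<Rightarrow>\<^sub>C complex) \<Rightarrow> complex) set" where
  "dual_bcontfun =
     {\<phi>. bounded_linear \<phi> \<and> (\<forall>c f. \<phi> (cscale_bcontfun c f) = c * \<phi> f)}"

definition weak_topology_bcontfun :: "('a::topological_space \<Rightarrow>\<^sub>C complex) topology" where
  "weak_topology_bcontfun =
     topology_generated_by {\<phi> -` U | \<phi> U. \<phi> \<in> dual_bcontfun \<and> open U}"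

lemma topspace_weak_topology_bcontfun [simp]: "topspace weak_topology_bcontfun = UNIV"
proof -
  have "(\<lambda>_. 0) \<in> dual_bcontfun"
    by (simp add: dual_bcontfun_def bounded_linear_zero)
  then have "\<exists>\<phi> U. (UNIV :: ('a \<Rightarrow>\<^sub>C complex) set) = \<phi> -` U \<and> \<phi> \<in> dual_bcontfun \<and> open U"
    by (metis vimage_UNIV open_UNIV)
  then show ?thesis
    unfolding weak_topology_bcontfun_def topology_generated_by_topspace by blast
qed

definition relatively_norm_compact :: "('a::topological_space \<Rightarrow>\<^sub>C complex) set \<Rightarrow> bool" where
  "relatively_norm_compact A \<longleftrightarrow> compact (closure A)"

definition relatively_weakly_compact :: "('a::topological_space \<Rightarrow>\<^sub>C complex) set \<Rightarrow> bool" where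
  "relatively_weakly_compact A \<longleftrightarrow>
     compactin weak_topology_bcontfun (weak_topology_bcontfun closure_of A)"

subsection \<open>Orbits and function spaces\<close>

lemma bcontfun_comp_continuous:
  assumes "f \<in> bcontfun" "continuous_on UNIV g"
  shows "(\<lambda>z. f (g z)) \<in> bcontfun"
proof -
  have "continuous_on UNIV (\<lambda>z. f (g z))"
    using continuous_on_compose2[of UNIV f UNIV g] assms by (simp add: bcontfun_def)
  moreover have "bounded (range (\<lambda>z. f (g z)))"
    by (rule bounded_subset[of "range f"]) (use assms in \<open>auto simp: bcontfun_def\<close>)
  ultimately show ?thesis
    by (simp add: bcontfun_def)
qed

lift_definition left_translate ::
    "'a::topological_group_add \<Rightarrow> ('a \<Rightarrow>\<^sub>C complex) \<Rightarrow> ('a \<Rightarrow>\<^sub>C complex)"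
  is "\<lambda>x f z. f (x + z)"
  by (rule bcontfun_comp_continuous) (auto intro!: continuous_intros)

lift_definition double_translate ::
    "'a::topological_group_add \<Rightarrow> 'a \<Rightarrow> ('a \<Rightarrow>\<^sub>C complex) \<Rightarrow> ('a \<Rightarrow>\<^sub>C complex)"
  is "\<lambda>x y f z. f (x + z + y)"
  by (rule bcontfun_comp_continuous) (auto intro!: continuous_intros)

definition left_orbit :: "('a::topological_group_add \<Rightarrow>\<^sub>C complex) \<Rightarrow> ('a \<Rightarrow>\<^sub>C complex) set" where
  "left_orbit f = {left_translate x f | x. True}"

definition double_orbit :: "('a::topological_group_add \<Rightarrow>\<^sub>C complex) \<Rightarrow> ('a \<Rightarrow>\<^sub>C complex) set" where
  "double_orbit f = {double_translate x y f | x y. True}"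

definition C0 :: "('a::topological_space \<Rightarrow>\<^sub>C complex) set" where
  "C0 = {f. \<forall>e>0. \<exists>K. compact K \<and> (\<forall>x. x \<notin> K \<longrightarrow> norm (apply_bcontfun f x) < e)}"

definition AP :: "('a::topological_group_add \<Rightarrow>\<^sub>C complex) set" where
  "AP = {f. relatively_norm_compact (left_orbit f)}"

definition WAP :: "('a::topological_group_add \<Rightarrow>\<^sub>C complex) set" where
  "WAP = {f. relatively_weakly_compact (left_orbit f)}"

definition WS :: "('a::topological_group_add \<Rightarrow>\<^sub>C complex) set" where
  "WS = {f. relatively_weakly_compact (double_orbit f)}"

text \<open>
  This predicate is meant for noncompact locally compact groups; the two conjuncts say
  that \<open>WAP(G)\<close> is the internal direct sum of \<open>AP(G)\<close> and \<open>C\<^sub>0(G)\<close>.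
\<close>

definition minimally_weakly_almost_periodic :: "'a::topological_group_add itself \<Rightarrow> bool" where
  "minimally_weakly_almost_periodic _ \<longleftrightarrow>
     (WAP :: ('a \<Rightarrow>\<^sub>C complex) set) = {g + h | g h. g \<in> AP \<and> h \<in> C0} \<and>
     (AP :: ('a \<Rightarrow>\<^sub>C complex) set) \<inter> C0 = {0}"

end

theory Submission
  imports Defs
begin

text \<open>
  The inclusion \<open>AP \<subseteq> WS\<close> holds in every topological group: the values \<open>f (x + z + y)\<close> of an almost
  periodic function depend, up to a small error, on finitely many parameters only, so its double
  orbit is totally bounded, and norm compact sets are weakly compact.

  For the converse let \<open>f \<in> WS\<close> and write \<open>f = g + h\<close> with \<open>g \<in> AP\<close> and \<open>h \<in> C0\<close>, which is possible as
  \<open>WS \<subseteq> WAP\<close>. It has to be shown that \<open>h = 0\<close>. A function with weakly relatively compact double orbit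
  is two-sided uniformly continuous: \<open>f (x + v + y)\<close> is close to \<open>f (x + y)\<close> for \<open>v\<close> near the identity,
  uniformly in \<open>x\<close> and \<open>y\<close>. This is a form of Namioka's theorem
  (\<open>pointwise_compact_small_oscillation\<close>) moved around by translations. It applies to \<open>f\<close> and to \<open>g\<close>, so \<open>h\<close>
  is two-sided uniformly continuous, too.

  Suppose \<open>h \<noteq> 0\<close>. Cutting off the small values of \<open>h\<close> and taking the infimum over all conjugations
  produces a nonzero central function \<open>\<psi> \<ge> 0\<close> with compact support, uniformly continuous as well
  (\<open>central_bump_exists\<close>); in particular the identity has a relatively compact neighbourhood that is
  invariant under conjugation. Since the group is not compact, one can place translates of \<open>\<psi>\<close> at
  the points of a very sparse sequence. Their sum is weakly almost periodic (\<open>bump_sum_in_WAP\<close>):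
  a left translate by an element near infinity is weakly close to zero or to a single translate of
  \<open>\<psi>\<close>, because what remains of different translates hardly overlaps, and bounded functions that
  hardly overlap tend weakly to zero (\<open>no_thinly_overlapping_family\<close>). On the other hand the sum of
  bumps does not belong to \<open>AP + C0\<close> (\<open>bump_sum_notin_AP_plus_C0\<close>): it does not vanish at infinity,
  yet it vanishes too often to have an almost periodic part. This contradicts the minimality of
  \<open>WAP\<close>, so \<open>h = 0\<close> and \<open>f = g\<close> is almost periodic.
\<close>

section \<open>The weak topology of C(G)\<close>

lemma apply_cscale_bcontfun [simp]: "apply_bcontfun (cscale_bcontfun c f) z = c * apply_bcontfun f z"
  by transfer simp

lemma evaluation_in_dual: "(\<lambda>f. apply_bcontfun f z) \<in> dual_bcontfun"
proof -
  have "bounded_linear (\<lambda>f::'a \<Rightarrow>\<^sub>C complex. apply_bcontfun f z)"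
    by (rule bounded_linear_intro[where K = 1]) (simp_all add: norm_bounded)
  then show ?thesis
    by (simp add: dual_bcontfun_def)
qed

lemma dual_bounded_linear: "\<phi> \<in> dual_bcontfun \<Longrightarrow> bounded_linear \<phi>"
  by (simp add: dual_bcontfun_def)

lemma openin_weak_vimage:
  "\<phi> \<in> dual_bcontfun \<Longrightarrow> open U \<Longrightarrow> openin weak_topology_bcontfun (\<phi> -` U)"
  unfolding weak_topology_bcontfun_def by (rule topology_generated_by_Basis) blast

lemma weak_open_contains_basic_neighbourhood:
  assumes "openin weak_topology_bcontfun W" and "f \<in> W"
  shows "\<exists>\<Phi> \<epsilon>. finite \<Phi> \<and> \<Phi> \<subseteq> dual_bcontfun \<and> \<epsilon> > 0 \<and>
           (\<forall>g. (\<forall>\<phi>\<in>\<Phi>. norm (\<phi> (g - f)) < \<epsilon>) \<longrightarrow> g \<in> W)"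
proof -
  have "generate_topology_on {\<phi> -` U | \<phi> U. \<phi> \<in> dual_bcontfun \<and> open U} W"
    using assms(1) unfolding weak_topology_bcontfun_def
    by (rule openin_topology_generated_by)
  then show ?thesis
    using assms(2)
  proof (induction W rule: generate_topology_on.induct)
    case Empty
    then show ?case by simp
  next
    case (Int a b)
    then obtain \<Phi> \<epsilon> \<Psi> \<delta> where
      "finite \<Phi>" "\<Phi> \<subseteq> dual_bcontfun" "\<epsilon> > 0"
      "\<forall>g. (\<forall>\<phi>\<in>\<Phi>. norm (\<phi> (g - f)) < \<epsilon>) \<longrightarrow> g \<in> a"
      "finite \<Psi>" "\<Psi> \<subseteq> dual_bcontfun" "\<delta> > 0"
      "\<forall>g. (\<forall>\<phi>\<in>\<Psi>. norm (\<phi> (g - f)) < \<delta>) \<longrightarrow> g \<in> b"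
      by auto
    then show ?case
      by (intro exI[of _ "\<Phi> \<union> \<Psi>"] exI[of _ "min \<epsilon> \<delta>"]) auto
  next
    case (UN K)
    then obtain k where k: "k \<in> K" "f \<in> k"
      by blast
    with UN.IH obtain \<Phi> \<epsilon> where "finite \<Phi>" "\<Phi> \<subseteq> dual_bcontfun" "\<epsilon> > 0"
      "\<forall>g. (\<forall>\<phi>\<in>\<Phi>. norm (\<phi> (g - f)) < \<epsilon>) \<longrightarrow> g \<in> k"
      by metis
    with k show ?case
      by (intro exI[of _ \<Phi>] exI[of _ \<epsilon>]) auto
  next
    case (Basis s)
    then obtain \<phi> U where \<phi>: "s = \<phi> -` U" "\<phi> \<in> dual_bcontfun" "open U"
      by blast
    with Basis obtain \<epsilon> where \<epsilon>: "\<epsilon> > 0" "ball (\<phi> f) \<epsilon> \<subseteq> U"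
      using openE by (metis vimageE)
    have "g \<in> s" if "norm (\<phi> (g - f)) < \<epsilon>" for g
    proof -
      have "\<phi> (g - f) = \<phi> g - \<phi> f"
        using dual_bounded_linear[OF \<phi>(2)]
        by (simp add: linear_diff bounded_linear.linear)
      then have "dist (\<phi> f) (\<phi> g) < \<epsilon>"
        using that by (simp add: dist_norm norm_minus_commute)
      then show ?thesis
        using \<epsilon> \<phi> by auto
    qed
    then show ?case
      using \<phi> \<epsilon> by (intro exI[of _ "{\<phi>}"] exI[of _ \<epsilon>]) auto
  qed
qed

lemma weak_open_imp_open:
  assumes "openin weak_topology_bcontfun W"
  shows "open W"
proof -
  have "generate_topology_on {\<phi> -` U | \<phi> U. \<phi> \<in> dual_bcontfun \<and> open U} W"
    using assms unfolding weak_topology_bcontfun_def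
    by (rule openin_topology_generated_by)
  then show ?thesis
  proof (induction W rule: generate_topology_on.induct)
    case (Basis s)
    then obtain \<phi> U where \<phi>: "s = \<phi> -` U" "\<phi> \<in> dual_bcontfun" "open U"
      by blast
    then show ?case
      using open_vimage[OF \<phi>(3)] bounded_linear.continuous_on[OF dual_bounded_linear[OF \<phi>(2)] continuous_on_id]
      by blast
  qed auto
qed

lemma norm_compact_imp_weakly_compact:
  assumes "compact K"
  shows "compactin weak_topology_bcontfun K"
proof -
  have "continuous_map euclidean weak_topology_bcontfun id"
    by (auto simp: continuous_map_def weak_open_imp_open)
  from image_compactin[OF _ this, of K] show ?thesis
    using assms by simp
qed

lemma Hausdorff_space_weak_topology: "Hausdorff_space weak_topology_bcontfun"
  unfolding Hausdorff_space_def
proof (intro allI impI)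
  fix f g :: "'a \<Rightarrow>\<^sub>C complex"
  assume "f \<in> topspace weak_topology_bcontfun \<and> g \<in> topspace weak_topology_bcontfun \<and> f \<noteq> g"
  then obtain z where "apply_bcontfun f z \<noteq> apply_bcontfun g z"
    using bcontfun_eqI by blast
  then obtain U V where UV: "open U" "open V" "apply_bcontfun f z \<in> U" "apply_bcontfun g z \<in> V" "U \<inter> V = {}"
    using hausdorff by metis
  let ?e = "\<lambda>h::'a \<Rightarrow>\<^sub>C complex. apply_bcontfun h z"
  show "\<exists>U V. openin weak_topology_bcontfun U \<and> openin weak_topology_bcontfun V \<and>
      f \<in> U \<and> g \<in> V \<and> disjnt U V"
    using UV openin_weak_vimage[OF evaluation_in_dual]
    by (intro exI[of _ "?e -` U"] exI[of _ "?e -` V"]) (auto simp: disjnt_def)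
qed

lemma relatively_weakly_compactI:
  assumes "compactin weak_topology_bcontfun Q" and "A \<subseteq> Q"
  shows "relatively_weakly_compact A"
proof -
  have "closedin weak_topology_bcontfun Q"
    using assms(1) Hausdorff_space_weak_topology compactin_imp_closedin by blast
  then show ?thesis
    unfolding relatively_weakly_compact_def
    by (meson assms closed_compactin closedin_closure_of closure_of_minimal)
qed

lemma relatively_weakly_compact_subset:
  assumes "relatively_weakly_compact A" and "B \<subseteq> A"
  shows "relatively_weakly_compact B"
  using relatively_weakly_compactI assms closure_of_subset[of A weak_topology_bcontfun]
  unfolding relatively_weakly_compact_def by fastforce

lemma relatively_weakly_compact_imp_pointwise:
  assumes "relatively_weakly_compact A"
  shows "\<exists>Q. compact Q \<and> (\<forall>q\<in>Q. continuous_on UNIV q) \<and> apply_bcontfun ` A \<subseteq> Q"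
proof -
  let ?Q = "weak_topology_bcontfun closure_of A"
  have "continuous_map weak_topology_bcontfun (euclidean :: ('a \<Rightarrow> complex) topology) apply_bcontfun"
    unfolding euclidean_product_topology[symmetric] continuous_map_componentwise_UNIV
  proof (intro allI)
    fix z :: 'a
    show "continuous_map weak_topology_bcontfun euclidean (\<lambda>x. apply_bcontfun x z)"
      using openin_weak_vimage[OF evaluation_in_dual[of z]]
      by (auto simp: continuous_map_def vimage_def)
  qed
  then have "compactin euclidean (apply_bcontfun ` ?Q)"
    using assms image_compactin unfolding relatively_weakly_compact_def by blast
  moreover have "A \<subseteq> ?Q"
    by (simp add: closure_of_subset)
  ultimately show ?thesis
    by (intro exI[of _ "apply_bcontfun ` ?Q"]) auto
qed

text \<open>
  A basic neighbourhood is only available around a single point; by compactness finitely many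
  functionals and one tolerance serve all points of \<open>B\<close> at once.
\<close>

lemma weakly_compact_uniform_neighbourhood:
  assumes B: "compactin weak_topology_bcontfun B"
    and W: "openin weak_topology_bcontfun W" "B \<subseteq> W"
  obtains \<Phi> \<epsilon> where "finite \<Phi>" "\<Phi> \<subseteq> dual_bcontfun" "\<epsilon> > 0"
    "\<And>b f. b \<in> B \<Longrightarrow> (\<And>\<phi>. \<phi> \<in> \<Phi> \<Longrightarrow> norm (\<phi> (f - b)) < \<epsilon>) \<Longrightarrow> f \<in> W"
proof -
  have "\<forall>b\<in>B. \<exists>\<Phi> \<epsilon>. finite \<Phi> \<and> \<Phi> \<subseteq> dual_bcontfun \<and> \<epsilon> > 0 \<and>
           (\<forall>g. (\<forall>\<phi>\<in>\<Phi>. norm (\<phi> (g - b)) < \<epsilon>) \<longrightarrow> g \<in> W)"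
    using weak_open_contains_basic_neighbourhood[OF W(1)] W(2) by blast
  then obtain \<Psi> \<delta> where \<Psi>: "\<And>b. b \<in> B \<Longrightarrow> finite (\<Psi> b)" "\<And>b. b \<in> B \<Longrightarrow> \<Psi> b \<subseteq> dual_bcontfun"
      and \<delta>: "\<And>b. b \<in> B \<Longrightarrow> \<delta> b > (0::real)"
      and \<Psi>\<delta>: "\<And>b g. b \<in> B \<Longrightarrow> (\<And>\<phi>. \<phi> \<in> \<Psi> b \<Longrightarrow> norm (\<phi> (g - b)) < \<delta> b) \<Longrightarrow> g \<in> W"
    by metis
  define N where "N b = (\<Inter>\<phi>\<in>\<Psi> b. \<phi> -` ball (\<phi> b) (\<delta> b / 2))" for b
  have N: "openin weak_topology_bcontfun (N b)" "b \<in> N b" if "b \<in> B" for b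
  proof -
    show "b \<in> N b"
      using \<delta>[OF that] by (simp add: N_def)
    show "openin weak_topology_bcontfun (N b)"
    proof (cases "\<Psi> b = {}")
      case True
      then show ?thesis
        using openin_topspace[of weak_topology_bcontfun] by (simp add: N_def)
    next
      case False
      then show ?thesis
        unfolding N_def using \<Psi>[OF that] openin_weak_vimage
        by (intro openin_INT2) auto
    qed
  qed
  obtain F where F: "finite F" "F \<subseteq> B" "B \<subseteq> \<Union>(N ` F)"
  proof -
    have "B \<subseteq> \<Union>(N ` B)" "\<forall>U\<in>N ` B. openin weak_topology_bcontfun U"
      using N by auto
    then obtain \<F> where "finite \<F>" "\<F> \<subseteq> N ` B" "B \<subseteq> \<Union>\<F>"
      using B unfolding compactin_def by meson
    then show ?thesis
      using that by (metis finite_subset_image)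
  qed
  define \<epsilon> where "\<epsilon> = Min (insert 1 ((\<lambda>b. \<delta> b / 2) ` F))"
  show ?thesis
  proof
    show "finite (\<Union>(\<Psi> ` F))"
      using F \<Psi> by auto
    show "\<Union>(\<Psi> ` F) \<subseteq> dual_bcontfun"
      using F(2) \<Psi>(2) by blast
    show "\<epsilon> > 0"
      unfolding \<epsilon>_def using F \<delta> by (subst Min_gr_iff) auto
  next
    fix b f
    assume b: "b \<in> B" and f: "\<And>\<phi>. \<phi> \<in> \<Union>(\<Psi> ` F) \<Longrightarrow> norm (\<phi> (f - b)) < \<epsilon>"
    obtain c where c: "c \<in> F" "b \<in> N c"
      using F b by blast
    have "norm (\<phi> (f - c)) < \<delta> c" if \<phi>: "\<phi> \<in> \<Psi> c" for \<phi>
    proof -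
      have "linear \<phi>"
        using \<Psi> c F \<phi> dual_bounded_linear bounded_linear.linear by blast
      then have "\<phi> (f - c) = \<phi> (f - b) + (\<phi> b - \<phi> c)"
        by (simp add: linear_diff)
      moreover have "norm (\<phi> (f - b)) < \<delta> c / 2"
      proof -
        have "norm (\<phi> (f - b)) < \<epsilon>"
          using f c \<phi> by blast
        also have "\<epsilon> \<le> \<delta> c / 2"
          unfolding \<epsilon>_def using F c by (intro Min_le) auto
        finally show ?thesis .
      qed
      moreover have "norm (\<phi> b - \<phi> c) < \<delta> c / 2"
        using c \<phi> by (auto simp: N_def dist_norm norm_minus_commute)
      ultimately show ?thesis
        using norm_triangle_ineq[of "\<phi> (f - b)" "\<phi> b - \<phi> c"] by simp
    qed
    then show "f \<in> W"
      using \<Psi>\<delta>[of c] c F by blast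
  qed
qed

text \<open>
  The mechanism of a one-point compactification: a continuous family over the group whose
  members enter every weak neighbourhood of a weakly compact set \<open>Q\<close> as the parameter tends to
  infinity becomes weakly compact once \<open>Q\<close> is adjoined, because what remains outside the
  neighbourhood is the continuous image of a compact set.
\<close>

lemma weakly_compact_adjoin_family:
  fixes X :: "'b::topological_space \<Rightarrow> ('a::topological_space \<Rightarrow>\<^sub>C complex)"
  assumes Q: "compactin weak_topology_bcontfun Q"
    and X: "continuous_on UNIV X"
    and lim: "\<And>W. openin weak_topology_bcontfun W \<Longrightarrow> Q \<subseteq> W \<Longrightarrow> \<exists>C. compact C \<and> (\<forall>x. x \<notin> C \<longrightarrow> X x \<in> W)"
  shows "compactin weak_topology_bcontfun (Q \<union> range X)"
  unfolding compactin_def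
proof (intro conjI allI impI)
  fix \<U>
  assume \<U>: "Ball \<U> (openin weak_topology_bcontfun) \<and> Q \<union> range X \<subseteq> \<Union>\<U>"
  then obtain \<V> where \<V>: "finite \<V>" "\<V> \<subseteq> \<U>" "Q \<subseteq> \<Union>\<V>"
    using Q unfolding compactin_def by (meson le_sup_iff)
  then obtain C where C: "compact C" "\<And>x. x \<notin> C \<Longrightarrow> X x \<in> \<Union>\<V>"
    using lim[of "\<Union>\<V>"] \<U> by (meson openin_Union subsetD)
  have "compactin weak_topology_bcontfun (X ` C)"
    using X C(1) by (meson compact_continuous_image continuous_on_subset norm_compact_imp_weakly_compact top_greatest)
  moreover have "X ` C \<subseteq> \<Union>\<U>"
    using \<U> by blast
  ultimately obtain \<T> where \<T>: "finite \<T>" "\<T> \<subseteq> \<U>" "X ` C \<subseteq> \<Union>\<T>"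
    using \<U> unfolding compactin_def by meson
  have "Q \<union> range X \<subseteq> \<Union>(\<V> \<union> \<T>)"
    using \<V> \<T> C(2) by fastforce
  then show "\<exists>\<F>. finite \<F> \<and> \<F> \<subseteq> \<U> \<and> Q \<union> range X \<subseteq> \<Union>\<F>"
    using \<V> \<T> by (intro exI[of _ "\<V> \<union> \<T>"]) auto
qed simp

text \<open>
  If the absolute values of finitely many functions add up to at most \<open>c\<close> at every point, then so
  do, up to the norm of the functional, the values of a functional on them: multiply each function
  by the unimodular constant that makes its value nonnegative.
\<close>

lemma sum_dual_values_le:
  assumes \<phi>: "\<phi> \<in> dual_bcontfun"
    and c: "\<And>z. (\<Sum>r\<leftarrow>rs. norm (apply_bcontfun r z)) \<le> c"
  shows "(\<Sum>r\<leftarrow>rs. norm (\<phi> r)) \<le> onorm \<phi> * c"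
proof -
  define u where "u r = (if \<phi> r = 0 then 0 else cnj (\<phi> r) / norm (\<phi> r))" for r
  define G where "G = (\<Sum>r\<leftarrow>rs. cscale_bcontfun (u r) r)"
  have bl: "bounded_linear \<phi>" and sc: "\<And>a f. \<phi> (cscale_bcontfun a f) = a * \<phi> f"
    using \<phi> by (auto simp: dual_bcontfun_def)
  have u: "u r * \<phi> r = norm (\<phi> r)" "norm (u r) \<le> 1" for r
    by (auto simp: u_def norm_divide complex_norm_square[symmetric] power2_eq_square mult.commute)
  have "\<phi> G = (\<Sum>r\<leftarrow>rs. u r * \<phi> r)"
    unfolding G_def
    by (induction rs) (simp_all add: sc linear_add linear_0 bounded_linear.linear[OF bl])
  also have "\<dots> = complex_of_real (\<Sum>r\<leftarrow>rs. norm (\<phi> r))"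
    by (induction rs) (simp_all add: u)
  finally have \<phi>G: "\<phi> G = complex_of_real (\<Sum>r\<leftarrow>rs. norm (\<phi> r))" .
  have "0 \<le> (\<Sum>r\<leftarrow>rs. norm (\<phi> r))"
    by (rule sum_list_nonneg) auto
  then have "norm (\<phi> G) = (\<Sum>r\<leftarrow>rs. norm (\<phi> r))"
    by (simp only: \<phi>G norm_of_real abs_of_nonneg)
  moreover have "norm G \<le> c"
  proof (rule norm_bound)
    fix z
    have "norm (apply_bcontfun G z) \<le> (\<Sum>r\<leftarrow>rs. norm (apply_bcontfun r z))"
      unfolding G_def
    proof (induction rs)
      case (Cons r rs)
      have "norm (u r * apply_bcontfun r z) \<le> norm (apply_bcontfun r z)"
        using u(2)[of r] by (simp add: norm_mult mult_left_le_one_le)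
      with Cons show ?case
        by (auto intro: order_trans[OF norm_triangle_ineq])
    qed simp
    also have "\<dots> \<le> c"
      by (rule c)
    finally show "norm (apply_bcontfun G z) \<le> c" .
  qed
  ultimately show ?thesis
    using onorm[OF bl, of G] mult_left_mono[OF _ onorm_pos_le[OF bl], of "norm G" c] by linarith
qed

text \<open>
  An elementary substitute for Grothendieck's double limit criterion. The hypothesis \<open>pick\<close> allows one to
  choose members of \<open>Y\<close> one after another so that at every point their absolute values add up to
  at most \<open>2 * M\<close>: the next function vanishes on the compact set outside of which the earlier ones
  do not overlap, so that at most two of all the functions are nonzero at any point. Finitely many
  functionals then have bounded total mass on arbitrarily many such functions.
\<close>

lemma no_thinly_overlapping_family:
  fixes Y :: "('a::t2_space \<Rightarrow>\<^sub>C complex) set"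
  assumes \<Phi>: "finite \<Phi>" "\<Phi> \<subseteq> dual_bcontfun" and \<epsilon>: "\<epsilon> > 0"
    and M: "\<And>r z. r \<in> Y \<Longrightarrow> norm (apply_bcontfun r z) \<le> M" "M \<ge> 0"
    and big: "\<And>r. r \<in> Y \<Longrightarrow> \<epsilon> \<le> (\<Sum>\<phi>\<in>\<Phi>. norm (\<phi> r))"
    and pick: "\<And>H P. finite H \<Longrightarrow> H \<subseteq> Y \<Longrightarrow> compact P \<Longrightarrow>
       \<exists>r\<in>Y. (\<forall>z\<in>P. apply_bcontfun r z = 0) \<and>
         (\<forall>h\<in>H. \<exists>P'. compact P' \<and> {z. apply_bcontfun r z \<noteq> 0 \<and> apply_bcontfun h z \<noteq> 0} \<subseteq> P')"
  shows False
proof -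
  have thin: "\<exists>rs. length rs = n \<and> set rs \<subseteq> Y \<and>
      (\<forall>z. (\<Sum>r\<leftarrow>rs. norm (apply_bcontfun r z)) \<le> 2 * M) \<and>
      (\<exists>P. compact P \<and> (\<forall>z. z \<notin> P \<longrightarrow> (\<Sum>r\<leftarrow>rs. norm (apply_bcontfun r z)) \<le> M))" for n
  proof (induction n)
    case 0
    then show ?case
      using M(2) by auto
  next
    case (Suc n)
    then obtain rs P where rs: "length rs = n" "set rs \<subseteq> Y"
        and two: "\<And>z. (\<Sum>r\<leftarrow>rs. norm (apply_bcontfun r z)) \<le> 2 * M"
        and P: "compact P" "\<And>z. z \<notin> P \<Longrightarrow> (\<Sum>r\<leftarrow>rs. norm (apply_bcontfun r z)) \<le> M"
      by auto
    obtain r where r: "r \<in> Y" "\<And>z. z \<in> P \<Longrightarrow> apply_bcontfun r z = 0"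
        and "\<forall>h\<in>set rs. \<exists>P'. compact P' \<and> {z. apply_bcontfun r z \<noteq> 0 \<and> apply_bcontfun h z \<noteq> 0} \<subseteq> P'"
      using pick[of "set rs" P] rs P(1) by auto
    then obtain R where R: "\<And>h. h \<in> set rs \<Longrightarrow> compact (R h)"
        "\<And>h z. h \<in> set rs \<Longrightarrow> apply_bcontfun r z \<noteq> 0 \<Longrightarrow> apply_bcontfun h z \<noteq> 0 \<Longrightarrow> z \<in> R h"
      by (metis (mono_tags, lifting) mem_Collect_eq subsetD)
    have "(\<Sum>q\<leftarrow>r # rs. norm (apply_bcontfun q z)) \<le> M" if "z \<notin> P \<union> \<Union>(R ` set rs)" for z
    proof (cases "apply_bcontfun r z = 0")
      case True
      then show ?thesis
        using P(2) that by simp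
    next
      case False
      then have "\<forall>h\<in>set rs. apply_bcontfun h z = 0"
        using R(2) that by blast
      then have "(\<Sum>q\<leftarrow>rs. norm (apply_bcontfun q z)) = 0"
        by (induction rs) auto
      then show ?thesis
        using M(1)[OF r(1)] by simp
    qed
    moreover have "(\<Sum>q\<leftarrow>r # rs. norm (apply_bcontfun q z)) \<le> 2 * M" for z
    proof (cases "z \<in> P")
      case True
      then show ?thesis
        using two[of z] r(2) by simp
    next
      case False
      then show ?thesis
        using P(2)[of z] M(1)[OF r(1), of z] by simp
    qed
    moreover have "compact (P \<union> \<Union>(R ` set rs))"
      using P(1) R(1) by (intro compact_Un compact_Union) auto
    ultimately show ?case
      using rs r(1) by (intro exI[of _ "r # rs"]) auto
  qed
  define T where "T = (\<Sum>\<phi>\<in>\<Phi>. onorm \<phi> * (2 * M))"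
  obtain n :: nat where n: "T < n * \<epsilon>"
    using reals_Archimedean3[OF \<epsilon>] by blast
  obtain rs where rs: "length rs = n" "set rs \<subseteq> Y" "\<And>z. (\<Sum>r\<leftarrow>rs. norm (apply_bcontfun r z)) \<le> 2 * M"
    using thin[of n] by blast
  have "n * \<epsilon> \<le> (\<Sum>r\<leftarrow>rs. \<Sum>\<phi>\<in>\<Phi>. norm (\<phi> r))"
  proof -
    have "length rs * \<epsilon> \<le> (\<Sum>r\<leftarrow>rs. \<Sum>\<phi>\<in>\<Phi>. norm (\<phi> r))"
      using rs(2)
    proof (induction rs)
      case (Cons r rs)
      then show ?case
        using big[of r] by (simp add: algebra_simps)
    qed simp
    with rs(1) show ?thesis
      by simp
  qed
  also have "\<dots> = (\<Sum>\<phi>\<in>\<Phi>. \<Sum>r\<leftarrow>rs. norm (\<phi> r))"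
    by (induction rs) (simp_all add: sum.distrib)
  also have "\<dots> \<le> T"
    unfolding T_def using \<Phi> rs(3) by (intro sum_mono sum_dual_values_le) auto
  finally show False
    using n by simp
qed

section \<open>Equicontinuity of weakly relatively compact orbits\<close>

lemma compact_sequence_cluster_point:
  fixes y :: "nat \<Rightarrow> 'a::topological_space"
  assumes "compact K" and "\<And>n. y n \<in> K"
  shows "\<exists>l\<in>K. \<forall>n. l \<in> closure (y ` {n..})"
proof -
  let ?F = "filtermap y sequentially"
  have "?F \<noteq> bot"
    by (simp add: filtermap_bot_iff)
  moreover have "eventually (\<lambda>x. x \<in> K) ?F"
    using assms(2) by (simp add: eventually_filtermap)
  ultimately obtain l where l: "l \<in> K" "inf (nhds l) ?F \<noteq> bot"
    using assms(1) unfolding compact_filter by blast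
  have "l \<in> closure (y ` {n..})" for n
  proof (rule ccontr)
    assume "l \<notin> closure (y ` {n..})"
    then have "eventually (\<lambda>x. x \<in> - closure (y ` {n..})) (nhds l)"
      by (intro eventually_nhds_in_open) auto
    moreover have "eventually (\<lambda>x. x \<in> closure (y ` {n..})) ?F"
      unfolding eventually_filtermap eventually_sequentially
      using closure_subset by (intro exI[of _ n]) fastforce
    ultimately have "eventually (\<lambda>x. False) (inf (nhds l) ?F)"
      unfolding eventually_inf by blast
    with l(2) show False
      by (simp add: eventually_False)
  qed
  with l(1) show ?thesis
    by blast
qed

text \<open>
  The dichotomy behind Namioka's theorem. If members of \<open>Q\<close> that nearly agree on the finite set
  \<open>P\<close> were uniformly close on \<open>U\<close>, then on \<open>U\<close> all of \<open>Q\<close> would be uniformly approximated by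
  finitely many continuous functions, since by compactness \<open>Q\<close> has only finitely many members up
  to near agreement on \<open>P\<close>; around any point of \<open>U\<close> this gives small oscillation.
\<close>

lemma disagreement_of_nearly_agreeing_functions:
  fixes Q :: "('a::topological_space \<Rightarrow> complex) set"
  assumes Q: "compact Q" "\<And>q. q \<in> Q \<Longrightarrow> continuous_on UNIV q"
    and osc: "\<And>V. open V \<Longrightarrow> V \<noteq> {} \<Longrightarrow> \<exists>q\<in>Q. \<exists>a\<in>V. \<exists>b\<in>V. dist (q a) (q b) \<ge> 5 * \<eta>"
    and "\<eta> > 0" "\<delta> > 0" "finite P" "open U" "U \<noteq> {}"
  shows "\<exists>q\<in>Q. \<exists>q'\<in>Q. \<exists>u\<in>U. (\<forall>p\<in>P. dist (q p) (q' p) < \<delta>) \<and> dist (q u) (q' u) > \<eta>"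
proof (rule ccontr)
  assume "\<not> ?thesis"
  then have close: "dist (q u) (q' u) \<le> \<eta>"
    if "q \<in> Q" "q' \<in> Q" "u \<in> U" "\<And>p. p \<in> P \<Longrightarrow> dist (q p) (q' p) < \<delta>" for q q' u
    using that by (meson not_le)
  define N where "N q = {q'. \<forall>p\<in>P. dist (q p) (q' p) < \<delta>}" for q :: "'a \<Rightarrow> complex"
  have "open (N q)" for q
  proof -
    have "N q = (\<Inter>p\<in>P. {q'. dist (q p) (q' p) < \<delta>})"
      by (auto simp: N_def)
    moreover have "open {q' :: 'a \<Rightarrow> complex. dist (q p) (q' p) < \<delta>}" for p
      by (intro open_Collect_less continuous_intros continuous_on_product_coordinates)
    ultimately show ?thesis
      using \<open>finite P\<close> by (simp add: open_INT)
  qed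
  moreover have "Q \<subseteq> (\<Union>q\<in>Q. N q)"
    using \<open>\<delta> > 0\<close> by (auto simp: N_def)
  ultimately obtain F where F: "F \<subseteq> Q" "finite F" "Q \<subseteq> (\<Union>q\<in>F. N q)"
    using compactE_image[OF Q(1), of Q N] by metis
  obtain u where u: "u \<in> U"
    using \<open>U \<noteq> {}\<close> by blast
  define V where "V = U \<inter> (\<Inter>q\<in>F. {z. dist (q z) (q u) < \<eta>})"
  have "open {z. dist (q z) (q u) < \<eta>}" if "q \<in> F" for q
    using F that Q(2) by (intro open_Collect_less continuous_intros) auto
  then have "open V"
    unfolding V_def using F \<open>open U\<close> by (intro open_Int open_INT) auto
  moreover have "u \<in> V"
    using u \<open>\<eta> > 0\<close> by (simp add: V_def)
  ultimately obtain q a b where q: "q \<in> Q" "a \<in> V" "b \<in> V" "dist (q a) (q b) \<ge> 5 * \<eta>"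
    using osc by blast
  obtain r where r: "r \<in> F" "q \<in> N r"
    using F q by blast
  have "dist (r z) (q z) \<le> \<eta>" if "z \<in> V" for z
    using close[of r q z] r q F that by (auto simp: N_def V_def)
  then have "dist (r a) (q a) \<le> \<eta>" "dist (r b) (q b) \<le> \<eta>"
    using q by auto
  moreover have "dist (r a) (r u) < \<eta>" "dist (r b) (r u) < \<eta>"
    using q r by (auto simp: V_def)
  ultimately show False
    using q(4) \<open>\<eta> > 0\<close> dist_triangle3[of "q a" "q b" "r a"] dist_triangle[of "r a" "q b" "r b"]
      dist_triangle2[of "r a" "r b" "r u"] by linarith
qed

text \<open>
  A form of Namioka's theorem on joint continuity. If the oscillation were large everywhere, one
  could choose points \<open>x n\<close>, pairs of functions and shrinking compact sets such that the
  \<open>n\<close>-th pair nearly agrees at the earlier points and differs by at least \<open>\<eta>\<close> on the \<open>n\<close>-th compact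
  set. A cluster point of the pairs then consists of two continuous functions that agree at every
  \<open>x n\<close> but differ at a cluster point of the sequence \<open>x\<close>.
\<close>

lemma pointwise_compact_small_oscillation:
  fixes Q :: "('a::t2_space \<Rightarrow> complex) set"
  assumes lc: "locally_compact_space (euclidean :: 'a topology)"
    and Q: "compact Q" "\<And>q. q \<in> Q \<Longrightarrow> continuous_on UNIV q"
    and "\<epsilon> > 0"
  shows "\<exists>U. open U \<and> U \<noteq> {} \<and> (\<forall>q\<in>Q. \<forall>a\<in>U. \<forall>b\<in>U. dist (q a) (q b) < \<epsilon>)"
proof (rule ccontr)
  \<comment> \<open>a fifth, for the triangle inequality through an approximating function and a base point\<close>
  define \<eta> where "\<eta> = \<epsilon> / 5"
  have \<eta>: "\<eta> > 0" "\<epsilon> = 5 * \<eta>"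
    using \<open>\<epsilon> > 0\<close> by (auto simp: \<eta>_def)
  assume "\<not> ?thesis"
  then have osc: "\<exists>q\<in>Q. \<exists>a\<in>V. \<exists>b\<in>V. dist (q a) (q b) \<ge> 5 * \<eta>" if "open V" "V \<noteq> {}" for V
    using that \<eta>(2) by (meson not_le)
  have nb: "\<exists>C. compact C \<and> u \<in> interior C \<and> C \<subseteq> U" if U: "open U" "u \<in> U" for u :: 'a and U
  proof -
    have "Hausdorff_space (euclidean :: 'a topology)"
      by (auto simp: Hausdorff_space_def disjnt_def dest!: hausdorff)
    then have "neighbourhood_base_of (\<lambda>C. compactin euclidean C \<and> closedin euclidean C) (euclidean :: 'a topology)"
      using lc locally_compact_space_neighbourhood_base_closedin by blast
    then obtain V C where "open V" "compact C" "u \<in> V" "V \<subseteq> C" "C \<subseteq> U"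
      using U unfolding neighbourhood_base_of by (metis compactin_euclidean_iff open_openin)
    then show ?thesis
      by (meson interior_maximal subsetD)
  qed
  define inv where "inv = (\<lambda>(C, P, q, q', x). compact (C::'a set) \<and> interior C \<noteq> {} \<and> finite (P::'a set) \<and>
      q \<in> Q \<and> q' \<in> Q \<and> x \<in> C \<and> x \<in> P \<and> (\<forall>z\<in>C. dist (q z :: complex) (q' z) \<ge> \<eta>))"
  define step where "step n = (\<lambda>(C, P, q :: 'a \<Rightarrow> complex, q' :: 'a \<Rightarrow> complex, x :: 'a) (C1, P1, q1, q1', x1 :: 'a).
      C1 \<subseteq> (C::'a set) \<and> (P::'a set) \<subseteq> P1 \<and> (\<forall>p\<in>P. dist (q1 p :: complex) (q1' p) < 1 / Suc n))" for n
  have extend: "\<exists>C1 q1 q1' x1. inv (C1, insert x1 P, q1, q1', x1) \<and> C1 \<subseteq> U \<and>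
      (\<forall>p\<in>P. dist (q1 p) (q1' p) < 1 / Suc n)"
    if U: "open U" "U \<noteq> {}" and "finite P" for U P n
  proof -
    obtain q q' u where q: "q \<in> Q" "q' \<in> Q" "u \<in> U" "\<And>p. p \<in> P \<Longrightarrow> dist (q p) (q' p) < 1 / Suc n"
        "dist (q u) (q' u) > \<eta>"
      using disagreement_of_nearly_agreeing_functions[OF Q osc \<eta>(1) _ \<open>finite P\<close> U, of "1 / Suc n"]
      by fastforce
    have "open (U \<inter> {z. dist (q z) (q' z) > \<eta>})"
      using U Q(2) q by (intro open_Int open_Collect_less continuous_intros) auto
    then obtain C where C: "compact C" "u \<in> interior C" "C \<subseteq> U \<inter> {z. dist (q z) (q' z) > \<eta>}"
      using nb[of "U \<inter> {z. dist (q z) (q' z) > \<eta>}" u] q by blast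
    have "inv (C, insert u P, q, q', u)"
      using C q \<open>finite P\<close> interior_subset[of C] by (auto simp: inv_def)
    with C q show ?thesis
      by blast
  qed
  have "\<exists>f. \<forall>n::nat. inv (f n) \<and> step n (f n) (f (Suc n))"
  proof (rule dependent_nat_choice)
    show "\<exists>s. inv s"
      using extend[of UNIV "{}"] by blast
  next
    fix s and n :: nat
    assume s: "inv s"
    obtain C P q q' x where sq: "s = (C, P, q, q', x)"
      by (cases s)
    have "interior C \<noteq> {}" "finite P"
      using s by (auto simp: sq inv_def)
    from extend[OF open_interior this, of n]
    obtain C1 q1 q1' x1 where "inv (C1, insert x1 P, q1, q1', x1)" "C1 \<subseteq> interior C"
        "\<forall>p\<in>P. dist (q1 p) (q1' p) < 1 / Suc n"
      by blast
    then show "\<exists>s'. inv s' \<and> step n s s'"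
      using interior_subset[of C] sq
      by (intro exI[of _ "(C1, insert x1 P, q1, q1', x1)"]) (auto simp: step_def)
  qed
  then obtain f where f: "\<And>n. inv (f n)" "\<And>n. step n (f n) (f (Suc n))"
    by blast
  define C P q q' x where "C n = fst (f n)" and "P n = fst (snd (f n))" and "q n = fst (snd (snd (f n)))"
    and "q' n = fst (snd (snd (snd (f n))))" and "x n = snd (snd (snd (snd (f n))))" for n
  have feq: "f n = (C n, P n, q n, q' n, x n)" for n
    by (simp add: C_def P_def q_def q'_def x_def)
  have C: "compact (C n)" "x n \<in> C n" "x n \<in> P n" "q n \<in> Q" "q' n \<in> Q"
    and diff: "\<And>z. z \<in> C n \<Longrightarrow> dist (q n z) (q' n z) \<ge> \<eta>" for n
    using f(1)[of n] unfolding feq inv_def by auto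
  have S: "C (Suc n) \<subseteq> C n" "P n \<subseteq> P (Suc n)"
    and agree: "\<And>p. p \<in> P n \<Longrightarrow> dist (q (Suc n) p) (q' (Suc n) p) < 1 / Suc n" for n
    using f(2)[of n] unfolding feq step_def by auto
  have Cm: "C n \<subseteq> C m" and Pm: "P m \<subseteq> P n" if "m \<le> n" for m n
    using that lift_Suc_antimono_le[of C, OF S(1)] lift_Suc_mono_le[of P, OF S(2)] by auto
  have xC: "x n \<in> C 0" for n
    using C(2)[of n] Cm[of 0 n] by auto
  obtain l where l: "\<And>n. l \<in> closure (x ` {n..})"
    using compact_sequence_cluster_point[of "C 0" x, OF C(1) xC] by (elim bexE) auto
  have lC: "l \<in> C n" for n
  proof -
    have "x ` {n..} \<subseteq> C n"
      using C(2) Cm by fastforce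
    then show ?thesis
      using l[of n] closure_minimal[OF _ compact_imp_closed[OF C(1)[of n]]] by blast
  qed
  have qQ: "(q n, q' n) \<in> Q \<times> Q" for n
    using C by auto
  obtain r where r: "r \<in> Q \<times> Q" "\<And>n. r \<in> closure ((\<lambda>n. (q n, q' n)) ` {n..})"
    using compact_sequence_cluster_point[OF compact_Times[OF Q(1) Q(1)], of "\<lambda>n. (q n, q' n)", OF qQ]
    by (elim bexE) simp
  have cont: "continuous_on UNIV (\<lambda>r :: ('a \<Rightarrow> complex) \<times> ('a \<Rightarrow> complex). dist (fst r z) (snd r z))" for z
    by (rule continuous_on_dist[OF
          continuous_on_compose2[OF continuous_on_product_coordinates continuous_on_fst[OF continuous_on_id] subset_UNIV]
          continuous_on_compose2[OF continuous_on_product_coordinates continuous_on_snd[OF continuous_on_id] subset_UNIV]])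
  have far: "dist (fst r l) (snd r l) \<ge> \<eta>"
  proof -
    have "closed {r :: ('a \<Rightarrow> complex) \<times> ('a \<Rightarrow> complex). dist (fst r l) (snd r l) \<ge> \<eta>}"
      using cont by (intro closed_Collect_le) auto
    moreover have "(\<lambda>n. (q n, q' n)) ` {0..} \<subseteq> {r. dist (fst r l) (snd r l) \<ge> \<eta>}"
      using diff lC by auto
    ultimately show ?thesis
      using r(2)[of 0] closure_minimal by blast
  qed
  have same: "dist (fst r (x m)) (snd r (x m)) \<le> 0" for m
  proof (rule field_le_epsilon)
    fix e :: real
    assume "e > 0"
    then obtain k where k: "1 / Suc k < e"
      using nat_approx_posE by blast
    let ?N = "Suc (max m k)"
    have "closed {r :: ('a \<Rightarrow> complex) \<times> ('a \<Rightarrow> complex). dist (fst r (x m)) (snd r (x m)) \<le> e}"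
      using cont by (intro closed_Collect_le) auto
    moreover have "(\<lambda>n. (q n, q' n)) ` {?N..} \<subseteq> {r. dist (fst r (x m)) (snd r (x m)) \<le> e}"
    proof clarsimp
      fix n
      assume "Suc (max m k) \<le> n"
      then obtain n' where n': "n = Suc n'" "m \<le> n'" "k \<le> n'"
        by (cases n) auto
      have "dist (q n (x m)) (q' n (x m)) < 1 / Suc n'"
        using agree[of "x m" n'] C(3)[of m] Pm[OF n'(2)] n'(1) by blast
      also have "\<dots> \<le> 1 / Suc k"
        using n'(3) by (simp add: frac_le)
      finally show "dist (q n (x m)) (q' n (x m)) \<le> e"
        using k by simp
    qed
    ultimately have "closure ((\<lambda>n. (q n, q' n)) ` {?N..}) \<subseteq> {r. dist (fst r (x m)) (snd r (x m)) \<le> e}"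
      by (rule closure_minimal[rotated])
    with r(2)[of ?N] show "dist (fst r (x m)) (snd r (x m)) \<le> 0 + e"
      by auto
  qed
  have "dist (fst r l) (snd r l) \<le> 0"
  proof -
    have "closed {z. dist (fst r z) (snd r z) \<le> 0}"
      using Q(2) r(1) by (intro closed_Collect_le continuous_intros) auto
    moreover have "x ` {0..} \<subseteq> {z. dist (fst r z) (snd r z) \<le> 0}"
      using same by blast
    ultimately show ?thesis
      using l[of 0] closure_minimal by blast
  qed
  with far show False
    using \<eta>(1) by linarith
qed

definition two_sided_uniformly_continuous :: "('a::topological_group_add \<Rightarrow> 'b::metric_space) \<Rightarrow> bool" where
  "two_sided_uniformly_continuous f \<longleftrightarrow>
     (\<forall>\<epsilon>>0. \<exists>V. open V \<and> 0 \<in> V \<and> (\<forall>v\<in>V. \<forall>x y. dist (f (x + v + y)) (f (x + y)) \<le> \<epsilon>))"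

text \<open>
  A neighbourhood on which the whole double orbit oscillates little can be moved to the identity,
  as the double orbit is invariant under translations from both sides.
\<close>

lemma WS_imp_two_sided_uniformly_continuous:
  fixes f :: "'a::{topological_group_add, t2_space} \<Rightarrow>\<^sub>C complex"
  assumes lc: "locally_compact_space (euclidean :: 'a topology)" and f: "f \<in> WS"
  shows "two_sided_uniformly_continuous (apply_bcontfun f)"
  unfolding two_sided_uniformly_continuous_def
proof (intro allI impI)
  fix \<epsilon> :: real
  assume "\<epsilon> > 0"
  have "relatively_weakly_compact (double_orbit f)"
    using f by (simp add: WS_def)
  from relatively_weakly_compact_imp_pointwise[OF this] obtain Q where
    Q: "compact Q" "\<And>q. q \<in> Q \<Longrightarrow> continuous_on UNIV q" "apply_bcontfun ` double_orbit f \<subseteq> Q"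
    by (elim exE conjE) simp
  obtain U u where U: "open U" "u \<in> U" "\<And>q a b. q \<in> Q \<Longrightarrow> a \<in> U \<Longrightarrow> b \<in> U \<Longrightarrow> dist (q a) (q b) < \<epsilon>"
    using pointwise_compact_small_oscillation[OF lc Q(1,2) \<open>\<epsilon> > 0\<close>] by blast
  let ?V = "(+) u -` U"
  have "open ?V"
    using U(1) by (intro open_vimage continuous_intros)
  moreover have "dist (apply_bcontfun f (x + v + y)) (apply_bcontfun f (x + y)) \<le> \<epsilon>" if "v \<in> ?V" for v x y
  proof -
    let ?g = "double_translate (x - u) y f"
    have "apply_bcontfun ?g \<in> Q"
      using Q(3) unfolding double_orbit_def by blast
    then have "dist (apply_bcontfun ?g (u + v)) (apply_bcontfun ?g u) < \<epsilon>"
      using U(2) that by (intro U(3)) auto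
    then show ?thesis
      by (simp add: double_translate.rep_eq add.assoc diff_conv_add_uminus del: add_uminus_conv_diff)
  qed
  ultimately show "\<exists>V. open V \<and> 0 \<in> V \<and>
      (\<forall>v\<in>V. \<forall>x y. dist (apply_bcontfun f (x + v + y)) (apply_bcontfun f (x + y)) \<le> \<epsilon>)"
    using U(2) by (intro exI[of _ ?V]) auto
qed

section \<open>Almost periodic functions have relatively compact double orbits\<close>

text \<open>
  The group carries no metric, so the completeness of the space of bounded continuous functions is
  derived from the completeness of uniform convergence.
\<close>

lemma complete_UNIV_bcontfun: "complete (UNIV :: ('a::topological_space \<Rightarrow>\<^sub>C complex) set)"
  unfolding complete_def
proof (intro allI impI)
  fix f :: "nat \<Rightarrow> ('a \<Rightarrow>\<^sub>C complex)"
  assume "(\<forall>n. f n \<in> UNIV) \<and> Cauchy f"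
  then obtain g where "uniform_limit UNIV f g sequentially"
    using uniformly_convergent_eq_cauchy[of "\<lambda>_. True" f]
    unfolding Cauchy_def uniform_limit_sequentially_iff
    by (metis dist_fun_lt_imp_dist_val_lt)
  from uniform_limit_bcontfunE[OF this sequentially_bot]
  obtain l where "f \<longlonglongrightarrow> l"
    by metis
  then show "\<exists>l\<in>UNIV. f \<longlonglongrightarrow> l"
    by blast
qed

lemma compact_closure_if_finite_nets:
  fixes A :: "('a::topological_space \<Rightarrow>\<^sub>C complex) set"
  assumes "\<And>e. e > 0 \<Longrightarrow> \<exists>F. finite F \<and> A \<subseteq> (\<Union>f\<in>F. cball f e)"
  shows "compact (closure A)"
  unfolding compact_eq_totally_bounded
proof (intro conjI allI impI)
  show "complete (closure A)"
    using complete_UNIV_bcontfun complete_Int_closed[of UNIV "closure A"] by simp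
next
  fix e :: real
  assume "e > 0"
  then obtain F where F: "finite F" "A \<subseteq> (\<Union>f\<in>F. cball f (e / 2))"
    using assms[of "e / 2"] by auto
  then have "closure A \<subseteq> (\<Union>f\<in>F. cball f (e / 2))"
    by (intro closure_minimal closed_UN) auto
  also have "\<dots> \<subseteq> (\<Union>f\<in>F. ball f e)"
    using \<open>e > 0\<close> by fastforce
  finally show "\<exists>k. finite k \<and> closure A \<subseteq> (\<Union>x\<in>k. ball x e)"
    using F(1) by blast
qed

lemma AP_finite_net:
  fixes f :: "'a::topological_group_add \<Rightarrow>\<^sub>C complex"
  assumes "f \<in> AP" "e > 0"
  obtains I where "finite I"
    "\<And>x. \<exists>i\<in>I. \<forall>z. dist (apply_bcontfun f (x + z)) (apply_bcontfun f (i + z)) < e"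
proof -
  have "compact (closure (left_orbit f))"
    using assms by (simp add: AP_def relatively_norm_compact_def)
  moreover have "closure (left_orbit f) \<subseteq> (\<Union>g\<in>left_orbit f. ball g e)"
  proof
    fix h
    assume "h \<in> closure (left_orbit f)"
    then obtain g where "g \<in> left_orbit f" "dist g h < e"
      using \<open>e > 0\<close> unfolding closure_approachable by meson
    then show "h \<in> (\<Union>g\<in>left_orbit f. ball g e)"
      by auto
  qed
  ultimately obtain F where F: "F \<subseteq> left_orbit f" "finite F" "closure (left_orbit f) \<subseteq> (\<Union>g\<in>F. ball g e)"
    using compactE_image[of _ "left_orbit f" "\<lambda>g. ball g e"] by (metis open_ball)
  then have "F \<subseteq> range (\<lambda>i. left_translate i f)"
    by (auto simp: left_orbit_def)
  then obtain I where I: "finite I" "F = (\<lambda>i. left_translate i f) ` I"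
    using finite_subset_image[OF F(2)] by metis
  have "\<exists>i\<in>I. \<forall>z. dist (apply_bcontfun f (x + z)) (apply_bcontfun f (i + z)) < e" for x
  proof -
    have "left_translate x f \<in> closure (left_orbit f)"
      using closure_subset[of "left_orbit f"] by (auto simp: left_orbit_def)
    then obtain i where "i \<in> I" "dist (left_translate i f) (left_translate x f) < e"
      using F(3) I(2) by auto
    then show ?thesis
      using dist_fun_lt_imp_dist_val_lt[of "left_translate i f" "left_translate x f" e]
      by (metis dist_commute left_translate.rep_eq)
  qed
  with I(1) that show ?thesis
    by blast
qed

text \<open>
  Let the left translates by \<open>I\<close> form an \<open>e\<close>-net of the left orbit. Up to multiples of \<open>e\<close>, the
  function \<open>z \<mapsto> f (x + z + y)\<close> only depends on which \<open>i \<in> I\<close> is close to \<open>x\<close> and on the values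
  \<open>f (j + y)\<close> for \<open>j \<in> I\<close>, and there are finitely many possibilities for these up to \<open>e\<close>.
\<close>

lemma AP_subset_WS:
  fixes f :: "'a::topological_group_add \<Rightarrow>\<^sub>C complex"
  assumes "f \<in> AP"
  shows "f \<in> WS"
proof -
  have "compact (closure (double_orbit f))"
  proof (rule compact_closure_if_finite_nets)
    fix d :: real
    assume "d > 0"
    define e where "e = d / 6"
    have "e > 0"
      using \<open>d > 0\<close> by (simp add: e_def)
    obtain I where I: "finite I" "\<And>x. \<exists>i\<in>I. \<forall>z. dist (apply_bcontfun f (x + z)) (apply_bcontfun f (i + z)) < e"
      using AP_finite_net[OF assms \<open>e > 0\<close>] by blast
    then obtain \<iota> where \<iota>: "\<And>x. \<iota> x \<in> I"
        "\<And>x z. dist (apply_bcontfun f (x + z)) (apply_bcontfun f (\<iota> x + z)) < e"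
      by metis
    have "compact (closure (range (apply_bcontfun f)))"
      by (simp add: compact_closure)
    then obtain K where K: "finite K" "closure (range (apply_bcontfun f)) \<subseteq> (\<Union>k\<in>K. ball k e)"
      using \<open>e > 0\<close> unfolding compact_eq_totally_bounded by blast
    then have "\<exists>k\<in>K. dist k (apply_bcontfun f z) < e" for z
      using closure_subset[of "range (apply_bcontfun f)"] by fastforce
    then obtain \<kappa> where \<kappa>: "\<And>z. \<kappa> z \<in> K" "\<And>z. dist (\<kappa> z) (apply_bcontfun f z) < e"
      by metis
    \<comment> \<open>the finitely many parameters that determine a two-sided translate up to \<open>6 * e\<close>\<close>
    define T where "T = (\<lambda>(x, y). (\<iota> x, restrict (\<lambda>j. \<kappa> (j + y)) I))"
    have "range T \<subseteq> I \<times> (I \<rightarrow>\<^sub>E K)"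
      using \<iota>(1) \<kappa>(1) by (auto simp: T_def)
    then have "finite (range T)"
      using I(1) K(1) by (meson finite_PiE finite_SigmaI finite_subset)
    then obtain R where R: "finite R" "range T = T ` R"
      by (metis finite_subset_image subset_refl)
    have net: "dist (double_translate x y f) (double_translate x' y' f) \<le> d" if T: "T (x, y) = T (x', y')" for x y x' y'
    proof (rule dist_bound)
      fix z
      let ?f = "apply_bcontfun f"
      define w where "w = \<iota> x + z"
      define j where "j = \<iota> w"
      have "\<iota> x' = \<iota> x" "\<kappa> (j + y) = \<kappa> (j + y')"
        using T \<iota>(1)[of w] by (auto simp: T_def j_def restrict_def fun_eq_iff split: if_splits)
      then have
        "dist (?f (x + z + y)) (?f (w + y)) < e" "dist (?f (w + y)) (?f (j + y)) < e"
        "dist (\<kappa> (j + y)) (?f (j + y)) < e" "dist (\<kappa> (j + y)) (?f (j + y')) < e"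
        "dist (?f (w + y')) (?f (j + y')) < e" "dist (?f (x' + z + y')) (?f (w + y')) < e"
        using \<iota>(2)[of x "z + y"] \<iota>(2)[of w y] \<kappa>(2)[of "j + y"] \<kappa>(2)[of "j + y'"] \<iota>(2)[of w y'] \<iota>(2)[of x' "z + y'"]
        by (auto simp: w_def j_def add.assoc)
      then have "dist (?f (x + z + y)) (?f (x' + z + y')) \<le> 6 * e"
        using dist_triangle[of "?f (x + z + y)" "?f (x' + z + y')" "?f (w + y)"]
          dist_triangle[of "?f (w + y)" "?f (x' + z + y')" "?f (j + y)"]
          dist_triangle[of "?f (j + y)" "?f (x' + z + y')" "\<kappa> (j + y)"]
          dist_triangle[of "\<kappa> (j + y)" "?f (x' + z + y')" "?f (j + y')"]
          dist_triangle[of "?f (j + y')" "?f (x' + z + y')" "?f (w + y')"]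
        by (simp add: dist_commute)
      then show "dist (apply_bcontfun (double_translate x y f) z) (apply_bcontfun (double_translate x' y' f) z) \<le> d"
        by (simp add: double_translate.rep_eq e_def)
    qed
    have "double_orbit f \<subseteq> (\<Union>g\<in>(\<lambda>(x, y). double_translate x y f) ` R. cball g d)"
    proof
      fix g
      assume "g \<in> double_orbit f"
      then obtain x y where g: "g = double_translate x y f"
        by (auto simp: double_orbit_def)
      have "T (x, y) \<in> T ` R"
        using R(2) by blast
      then obtain x' y' where "(x', y') \<in> R" "T (x', y') = T (x, y)"
        by (metis imageE surj_pair)
      then show "g \<in> (\<Union>g\<in>(\<lambda>(x, y). double_translate x y f) ` R. cball g d)"
        using net g by fastforce
    qed
    then show "\<exists>F. finite F \<and> double_orbit f \<subseteq> (\<Union>g\<in>F. cball g d)"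
      using R(1) by blast
  qed
  then show ?thesis
    unfolding WS_def
    using relatively_weakly_compactI[OF norm_compact_imp_weakly_compact closure_subset] by blast
qed

lemma WS_subset_WAP:
  fixes f :: "'a::topological_group_add \<Rightarrow>\<^sub>C complex"
  assumes "f \<in> WS"
  shows "f \<in> WAP"
proof -
  have "left_translate x f = double_translate x 0 f" for x
    by (rule bcontfun_eqI) (simp add: left_translate.rep_eq double_translate.rep_eq)
  then have "left_orbit f \<subseteq> double_orbit f"
    by (auto simp: left_orbit_def double_orbit_def)
  then show ?thesis
    using assms relatively_weakly_compact_subset by (auto simp: WS_def WAP_def)
qed

section \<open>Central bumps\<close>

text \<open>
  A normal form for words in a noncommutative group; \<open>add_uminus_conv_diff\<close> has to be removed from
  the simplifier where it is used.
\<close>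

lemmas group_normalize = add.assoc diff_conv_add_uminus minus_add

lemma compact_image_diff:
  fixes A B :: "'a::topological_group_add set"
  assumes "compact A" "compact B"
  shows "compact ((\<lambda>(a, b). a - b) ` (A \<times> B))"
  using assms by (intro compact_continuous_image compact_Times)
    (auto simp: case_prod_unfold intro!: continuous_intros)

lemma compact_image_left_add:
  fixes A :: "'a::topological_group_add set"
  assumes "compact A"
  shows "compact ((+) a ` A)"
  using assms by (intro compact_continuous_image continuous_intros) auto

lemma left_uniformly_continuous_imp_continuous:
  fixes f :: "'a::topological_group_add \<Rightarrow> 'b::metric_space"
  assumes "\<And>\<epsilon>. \<epsilon> > 0 \<Longrightarrow> \<exists>V. open V \<and> 0 \<in> V \<and> (\<forall>v\<in>V. \<forall>z. dist (f (v + z)) (f z) \<le> \<epsilon>)"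
  shows "continuous_on UNIV f"
  unfolding continuous_on_def
proof (intro ballI tendstoI)
  fix x :: 'a and e :: real
  assume "e > 0"
  obtain V where V: "open V" "0 \<in> V" "\<And>v z. v \<in> V \<Longrightarrow> dist (f (v + z)) (f z) \<le> e / 2"
    using assms[of "e / 2"] \<open>e > 0\<close> by auto
  have "open ((\<lambda>y. y - x) -` V)"
    using V(1) by (intro open_vimage continuous_intros)
  then have "eventually (\<lambda>y. y \<in> (\<lambda>y. y - x) -` V) (nhds x)"
    using V(2) by (intro eventually_nhds_in_open) auto
  then show "\<forall>\<^sub>F y in at x. dist (f y) (f x) < e"
    unfolding eventually_at_filter
  proof eventually_elim
    case (elim y)
    then have "dist (f (y - x + x)) (f x) \<le> e / 2"
      by (intro V(3)) simp
    then show ?case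
      using \<open>e > 0\<close> by simp
  qed
qed

lemma continuous_left_translate:
  fixes f :: "'a::topological_group_add \<Rightarrow>\<^sub>C complex"
  assumes "\<And>\<epsilon>. \<epsilon> > 0 \<Longrightarrow> \<exists>V. open V \<and> 0 \<in> V \<and>
      (\<forall>v\<in>V. \<forall>z. dist (apply_bcontfun f (v + z)) (apply_bcontfun f z) \<le> \<epsilon>)"
  shows "continuous_on UNIV (\<lambda>x. left_translate x f)"
proof (rule left_uniformly_continuous_imp_continuous)
  fix \<epsilon> :: real
  assume "\<epsilon> > 0"
  then obtain V where "open V" "0 \<in> V"
      "\<And>v z. v \<in> V \<Longrightarrow> dist (apply_bcontfun f (v + z)) (apply_bcontfun f z) \<le> \<epsilon>"
    using assms by meson
  then show "\<exists>V. open V \<and> 0 \<in> V \<and> (\<forall>v\<in>V. \<forall>z. dist (left_translate (v + z) f) (left_translate z f) \<le> \<epsilon>)"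
    by (intro exI[of _ V]) (auto intro!: dist_bound simp: left_translate.rep_eq add.assoc)
qed

locale central_bump =
  fixes \<psi> :: "'a::{topological_group_add, t2_space} \<Rightarrow> real" and K :: "'a set" and M :: real
  assumes nonneg: "\<psi> z \<ge> 0" and le_M: "\<psi> z \<le> M" and pos_0: "\<psi> 0 > 0"
    and central: "\<psi> (a + b) = \<psi> (b + a)"
    and uniform: "\<epsilon> > 0 \<Longrightarrow> \<exists>V. open V \<and> 0 \<in> V \<and> (\<forall>v\<in>V. \<forall>z. \<bar>\<psi> (v + z) - \<psi> z\<bar> \<le> \<epsilon>)"
    and compact_K: "compact K" and support: "\<psi> z \<noteq> 0 \<Longrightarrow> z \<in> K"

text \<open>
  Cut off the small values of \<open>h\<close> to obtain a function of compact support and take the infimum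
  over all conjugations, which makes it central. The two-sided uniform continuity of \<open>h\<close> bounds
  the oscillation of all conjugates at once; this keeps the infimum uniformly continuous.
\<close>

lemma central_bump_exists:
  fixes h :: "'a::{topological_group_add, t2_space} \<Rightarrow>\<^sub>C complex"
  assumes h0: "h \<in> C0" and h: "two_sided_uniformly_continuous (apply_bcontfun h)" and "h \<noteq> 0"
  shows "\<exists>\<psi> :: 'a \<Rightarrow> real. \<exists>K M. central_bump \<psi> K M"
proof -
  obtain p where p: "apply_bcontfun h p \<noteq> 0"
    using \<open>h \<noteq> 0\<close> bcontfun_eqI[of h 0] by auto
  define \<delta> where "\<delta> = norm (apply_bcontfun h p) / 2"
  have \<delta>: "\<delta> > 0"
    using p by (simp add: \<delta>_def)
  define \<phi> where "\<phi> z = max (norm (apply_bcontfun h (p + z)) - \<delta>) 0" for z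
  define \<psi> where "\<psi> z = (INF x. \<phi> (x + z - x))" for z
  have bdd: "bdd_below (range (\<lambda>x. \<phi> (x + z - x)))" for z
    by (rule bdd_belowI[of _ 0]) (auto simp: \<phi>_def)
  obtain K0 where K0: "compact K0" "\<And>z. z \<notin> K0 \<Longrightarrow> norm (apply_bcontfun h z) < \<delta>"
    using h0 \<delta> unfolding C0_def by blast
  have \<psi>_le: "\<psi> z \<le> \<phi> (x + z - x)" for x z
    unfolding \<psi>_def using bdd by (rule cINF_lower) simp
  have \<psi>_nonneg: "0 \<le> \<psi> z" for z
    unfolding \<psi>_def by (rule cINF_greatest) (auto simp: \<phi>_def)
  have conj: "\<psi> z \<le> \<psi> (w + z - w)" for w z
  proof (subst (2) \<psi>_def, rule cINF_greatest)
    fix x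
    have "\<psi> z \<le> \<phi> ((x + w) + z - (x + w))"
      by (rule \<psi>_le)
    also have "(x + w) + z - (x + w) = x + (w + z - w) - x"
      by (simp add: group_normalize del: add_uminus_conv_diff)
    finally show "\<psi> z \<le> \<phi> (x + (w + z - w) - x)" .
  qed simp
  have central: "\<psi> (a + b) = \<psi> (b + a)" for a b
    using conj[of "a + b" b] conj[of "b + a" a]
    by (simp add: group_normalize del: add_uminus_conv_diff)
  have "central_bump \<psi> ((+) (- p) ` K0) (norm h)"
  proof
    fix z
    show "\<psi> z \<ge> 0"
      by (rule \<psi>_nonneg)
    have "\<psi> z \<le> \<phi> z"
      using \<psi>_le[of z 0] by simp
    also have "\<dots> \<le> norm h"
      using norm_bounded[of h "p + z"] \<delta> by (auto simp: \<phi>_def)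
    finally show "\<psi> z \<le> norm h" .
    show "z \<in> (+) (- p) ` K0" if "\<psi> z \<noteq> 0"
    proof -
      have "\<phi> z \<noteq> 0"
        using that \<psi>_le[of z 0] \<psi>_nonneg[of z] by auto
      then have "p + z \<in> K0"
        using K0(2)[of "p + z"] by (auto simp: \<phi>_def max_def split: if_splits)
      then show ?thesis
        by (intro image_eqI[of _ _ "p + z"]) simp_all
    qed
    have "\<psi> 0 = \<delta>"
      by (simp add: \<psi>_def \<phi>_def \<delta>_def)
    then show "\<psi> 0 > 0"
      using \<delta> by simp
    show "compact ((+) (- p) ` K0)"
      using K0(1) by (rule compact_image_left_add)
  next
    show "\<psi> (a + b) = \<psi> (b + a)" for a b
      by (rule central)
  next
    fix \<epsilon> :: real
    assume "\<epsilon> > 0"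
    then obtain V where V: "open V" "0 \<in> V"
        "\<And>v x y. v \<in> V \<Longrightarrow> dist (apply_bcontfun h (x + v + y)) (apply_bcontfun h (x + y)) \<le> \<epsilon>"
      using h unfolding two_sided_uniformly_continuous_def by meson
    have \<phi>: "\<bar>\<phi> (x + (v + z) - x) - \<phi> (x + z - x)\<bar> \<le> \<epsilon>" if "v \<in> V" for v x z
    proof -
      have "dist (apply_bcontfun h (p + (x + (v + z) - x))) (apply_bcontfun h (p + (x + z - x))) \<le> \<epsilon>"
        using V(3)[OF that, of "p + x" "z - x"] by (simp add: group_normalize del: add_uminus_conv_diff)
      then have "\<bar>norm (apply_bcontfun h (p + (x + (v + z) - x))) - norm (apply_bcontfun h (p + (x + z - x)))\<bar> \<le> \<epsilon>"
        unfolding dist_norm using norm_triangle_ineq3 order_trans by blast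
      then show ?thesis
        unfolding \<phi>_def by linarith
    qed
    have "\<bar>\<psi> (v + z) - \<psi> z\<bar> \<le> \<epsilon>" if "v \<in> V" for v z
    proof -
      have "\<psi> (v + z) - \<epsilon> \<le> \<psi> z"
      proof (subst (2) \<psi>_def, rule cINF_greatest)
        show "\<psi> (v + z) - \<epsilon> \<le> \<phi> (x + z - x)" for x
          using \<phi>[OF that, of x z] \<psi>_le[of "v + z" x] by linarith
      qed simp
      moreover have "\<psi> z - \<epsilon> \<le> \<psi> (v + z)"
      proof (subst (2) \<psi>_def, rule cINF_greatest)
        show "\<psi> z - \<epsilon> \<le> \<phi> (x + (v + z) - x)" for x
          using \<phi>[OF that, of x z] \<psi>_le[of z x] by linarith
      qed simp
      ultimately show ?thesis
        by linarith
    qed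
    with V show "\<exists>V. open V \<and> 0 \<in> V \<and> (\<forall>v\<in>V. \<forall>z. \<bar>\<psi> (v + z) - \<psi> z\<bar> \<le> \<epsilon>)"
      by blast
  qed
  then show ?thesis
    by blast
qed

context central_bump
begin

lemma continuous_bump: "continuous_on UNIV \<psi>"
  using uniform by (intro left_uniformly_continuous_imp_continuous) (auto simp: dist_real_def)

lemma M_nonneg: "M \<ge> 0"
  using nonneg[of 0] le_M[of 0] by linarith

text \<open>
  The set of differences of points where the bump is positive: translates of the bump by \<open>u\<close> and
  \<open>v\<close> overlap only if \<open>u - v\<close> lies in it. Since the bump is central, it is invariant under
  conjugation, hence closed under cyclic permutation of words.
\<close>

definition D :: "'a set" where
  "D = {a - b | a b. \<psi> a \<noteq> 0 \<and> \<psi> b \<noteq> 0}"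

lemma D_I: "\<psi> a \<noteq> 0 \<Longrightarrow> \<psi> b \<noteq> 0 \<Longrightarrow> a - b \<in> D"
  unfolding D_def by auto

lemma D_cyclic: "x + y \<in> D \<longleftrightarrow> y + x \<in> D"
proof -
  have "y + x \<in> D" if "x + y \<in> D" for x y
  proof -
    from that obtain a b where ab: "x + y = a - b" "\<psi> a \<noteq> 0" "\<psi> b \<noteq> 0"
      by (auto simp: D_def)
    have "y + x = - x + (x + y) + x"
      by (simp add: group_normalize del: add_uminus_conv_diff)
    also have "\<dots> = (- x + a + x) - (- x + b + x)"
      unfolding ab(1) by (simp add: group_normalize del: add_uminus_conv_diff)
    finally have "y + x = (- x + a + x) - (- x + b + x)" .
    moreover have "\<psi> (- x + c + x) = \<psi> c" for c
      using central[of "- x + c" x] by simp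
    ultimately show ?thesis
      using ab by (simp add: D_I)
  qed
  then show ?thesis
    by blast
qed

lemma D_uminus: "x \<in> D \<Longrightarrow> - x \<in> D"
  unfolding D_def by force

lemma D_diff: "\<psi> (u + z) \<noteq> 0 \<Longrightarrow> \<psi> (v + z) \<noteq> 0 \<Longrightarrow> u - v \<in> D"
  unfolding D_def
  by (rule CollectI, rule exI[of _ "u + z"], rule exI[of _ "v + z"])
    (simp add: group_normalize del: add_uminus_conv_diff)

lemma D_subset: "D \<subseteq> (\<lambda>(a, b). a - b) ` (K \<times> K)"
  using support unfolding D_def by force

definition bump :: "'a \<Rightarrow>\<^sub>C complex" where
  "bump = Bcontfun (\<lambda>z. complex_of_real (\<psi> z))"

lemma apply_bump [simp]: "apply_bcontfun bump z = complex_of_real (\<psi> z)"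
proof -
  have "(\<lambda>z. complex_of_real (\<psi> z)) \<in> bcontfun"
    using continuous_bump nonneg le_M by (intro bcontfun_normI[where b = M] continuous_intros) auto
  then show ?thesis
    unfolding bump_def by (simp add: Bcontfun_inverse)
qed

definition bump_translates :: "('a \<Rightarrow>\<^sub>C complex) set" where
  "bump_translates = {0} \<union> range (\<lambda>c. left_translate c bump)"

text \<open>Translates of the bump far away from each other are disjoint, so they tend weakly to zero.\<close>

lemma weakly_compact_bump_translates: "compactin weak_topology_bcontfun bump_translates"
  unfolding bump_translates_def
proof (rule weakly_compact_adjoin_family)
  show "compactin weak_topology_bcontfun {0 :: 'a \<Rightarrow>\<^sub>C complex}"
    by (simp add: norm_compact_imp_weakly_compact)
  show "continuous_on UNIV (\<lambda>c. left_translate c bump)"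
    using uniform by (intro continuous_left_translate)
      (simp add: dist_norm del: of_real_diff add: of_real_diff[symmetric])
next
  fix W :: "('a \<Rightarrow>\<^sub>C complex) set"
  assume W: "openin weak_topology_bcontfun W" "{0} \<subseteq> W"
  then obtain \<Phi> \<epsilon> where \<Phi>: "finite \<Phi>" "\<Phi> \<subseteq> dual_bcontfun" "\<epsilon> > 0"
      "\<And>g. (\<And>\<phi>. \<phi> \<in> \<Phi> \<Longrightarrow> norm (\<phi> g) < \<epsilon>) \<Longrightarrow> g \<in> W"
    using weak_open_contains_basic_neighbourhood[OF W(1), of 0] by auto
  show "\<exists>C. compact C \<and> (\<forall>c. c \<notin> C \<longrightarrow> left_translate c bump \<in> W)"
  proof (rule ccontr)
    assume "\<not> ?thesis"
    then have far: "\<exists>c. c \<notin> C \<and> left_translate c bump \<notin> W" if "compact C" for C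
      using that by blast
    define Y where "Y = {left_translate c bump | c. left_translate c bump \<notin> W}"
    show False
    proof (rule no_thinly_overlapping_family[OF \<Phi>(1,2,3), of Y M])
      show "norm (apply_bcontfun r z) \<le> M" if "r \<in> Y" for r z
        using that nonneg le_M by (auto simp: Y_def left_translate.rep_eq)
      show "M \<ge> 0"
        by (rule M_nonneg)
      show "\<epsilon> \<le> (\<Sum>\<phi>\<in>\<Phi>. norm (\<phi> r))" if "r \<in> Y" for r
      proof -
        obtain \<phi> where "\<phi> \<in> \<Phi>" "norm (\<phi> r) \<ge> \<epsilon>"
          using \<Phi>(4)[of r] \<open>r \<in> Y\<close> by (force simp: Y_def)
        then show ?thesis
          using member_le_sum[of \<phi> \<Phi> "\<lambda>\<phi>. norm (\<phi> r)"] \<Phi>(1) by auto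
      qed
    next
      fix H P
      assume H: "finite H" "H \<subseteq> Y" and P: "compact (P :: 'a set)"
      obtain c where c: "c \<notin> (\<lambda>(a, b). a - b) ` (K \<times> P)" "left_translate c bump \<notin> W"
        using far[OF compact_image_diff[OF compact_K P]] by blast
      have "apply_bcontfun (left_translate c bump) z = 0" if "z \<in> P" for z
      proof (rule ccontr)
        assume "apply_bcontfun (left_translate c bump) z \<noteq> 0"
        then have "c + z \<in> K"
          by (simp add: left_translate.rep_eq support)
        then have "c \<in> (\<lambda>(a, b). a - b) ` (K \<times> P)"
          using that by (intro image_eqI[of _ _ "(c + z, z)"]) auto
        with c(1) show False
          by simp
      qed
      moreover have "\<exists>P'. compact P' \<and> {z. apply_bcontfun r z \<noteq> 0 \<and> apply_bcontfun h z \<noteq> 0} \<subseteq> P'"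
        if h: "h \<in> H" for h r
      proof -
        obtain d where d: "h = left_translate d bump"
          using h H(2) by (auto simp: Y_def)
        have "z \<in> (+) (- d) ` K" if "apply_bcontfun h z \<noteq> 0" for z
          using that support[of "d + z"] unfolding d
          by (intro image_eqI[of _ _ "d + z"]) (simp_all add: left_translate.rep_eq)
        then show ?thesis
          using compact_image_left_add[OF compact_K, of "- d"] by blast
      qed
      ultimately show "\<exists>r\<in>Y. (\<forall>z\<in>P. apply_bcontfun r z = 0) \<and>
          (\<forall>h\<in>H. \<exists>P'. compact P' \<and> {z. apply_bcontfun r z \<noteq> 0 \<and> apply_bcontfun h z \<noteq> 0} \<subseteq> P')"
        using c(2) by (intro bexI[of _ "left_translate c bump"]) (auto simp: Y_def)
    qed
  qed
qed

text \<open>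
  The condition excludes finitely many translates of a relatively compact set when \<open>s N\<close> is chosen.
  Up to inversion and cyclic permutation, which \<open>D\<close> allows, it covers every alternating word of
  length four whose largest index occurs once.
\<close>

lemma sparse_sequence_exists:
  assumes "\<not> compact (UNIV :: 'a set)"
  shows "\<exists>s :: nat \<Rightarrow> 'a. \<forall>N. \<forall>i<N. \<forall>j<N. \<forall>k<N. s N - s i + s j - s k \<notin> D"
proof -
  define P where "P = (\<lambda>(f :: nat \<Rightarrow> 'a) N r. \<forall>i<N. \<forall>j<N. \<forall>k<N. r - f i + f j - f k \<notin> D)"
  have "\<exists>s. \<forall>N. P s N (s N)"
  proof (rule dependent_wellorder_choice)
    show "P f x r = P g x r" if "\<And>y. y < x \<Longrightarrow> f y = g y" for r f g x
      using that by (simp add: P_def)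
  next
    fix N :: nat and f :: "nat \<Rightarrow> 'a"
    define KK where "KK = (\<lambda>(a, b). a - b) ` (K \<times> K)"
    define C where "C = (\<Union>i<N. \<Union>j<N. \<Union>k<N. (\<lambda>d. d + (f k - f j + f i)) ` KK)"
    have "compact KK"
      unfolding KK_def by (rule compact_image_diff[OF compact_K compact_K])
    then have "compact C"
      unfolding C_def by (intro compact_UN finite_lessThan compact_continuous_image continuous_intros)
    then have "C \<noteq> UNIV"
      using assms by auto
    then obtain r where r: "r \<notin> C"
      by auto
    have "r - f i + f j - f k \<notin> D" if "i < N" "j < N" "k < N" for i j k
    proof
      assume "r - f i + f j - f k \<in> D"
      then have "r - f i + f j - f k \<in> KK"
        using D_subset KK_def by blast
      moreover have "r = (r - f i + f j - f k) + (f k - f j + f i)"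
        by (simp add: group_normalize del: add_uminus_conv_diff)
      ultimately have "r \<in> C"
        unfolding C_def using that by blast
      with r show False
        by simp
    qed
    then show "\<exists>r. P f N r"
      by (auto simp: P_def)
  qed
  then show ?thesis
    by (simp add: P_def)
qed

end

section \<open>Sparse sums of central bumps are weakly almost periodic\<close>

locale sparse_bumps = central_bump +
  fixes s :: "nat \<Rightarrow> 'a"
  assumes sparse: "i < N \<Longrightarrow> j < N \<Longrightarrow> k < N \<Longrightarrow> s N - s i + s j - s k \<notin> D"
begin

lemma differences_notin_D:
  assumes "m \<noteq> n"
  shows "s m - s n \<notin> D" and "- s m + s n \<notin> D"
proof -
  have *: "s m - s n \<notin> D" if "n < m" for m n
    using sparse[of n m n n] that by simp
  show 1: "s m - s n \<notin> D"
  proof (cases "n < m")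
    case False
    then have "s n - s m \<notin> D"
      using * assms by simp
    then show ?thesis
      using D_uminus[of "s m - s n"] by auto
  qed (rule *)
  show "- s m + s n \<notin> D"
    using 1 * assms D_cyclic[of "- s m" "s n"] D_uminus[of "s n - s m"] by auto
qed

text \<open>
  A compact set is covered by finitely many translates of the open set where the bump is positive.
  By hypothesis two pairs of indices whose values fall into the same translate have the same
  maximum, so each translate catches finitely many pairs.
\<close>

lemma finite_pairs_in_compact:
  fixes d :: "nat \<Rightarrow> nat \<Rightarrow> 'a"
  assumes d: "\<And>m n k l. m \<noteq> n \<Longrightarrow> k < max m n \<Longrightarrow> l < max m n \<Longrightarrow> d m n - d k l \<notin> D"
    and P: "compact P"
  shows "finite {(m, n). m \<noteq> n \<and> d m n \<in> P}"
proof -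
  define N where "N g = {z. \<psi> (z - g) \<noteq> 0}" for g
  have "open (N g)" for g
    unfolding N_def
    by (intro open_Collect_neq continuous_on_compose2[OF continuous_bump] continuous_intros) auto
  moreover have "P \<subseteq> (\<Union>g\<in>P. N g)"
    using pos_0 by (auto simp: N_def)
  ultimately obtain G where G: "finite G" "P \<subseteq> (\<Union>g\<in>G. N g)"
    using compactE_image[OF P, of P N] by metis
  have "finite {(m, n). m \<noteq> n \<and> d m n \<in> N g}" (is "finite ?A") for g
  proof (cases "?A = {}")
    case True
    then show ?thesis
      by (simp only: finite.emptyI)
  next
    case False
    then obtain k l where kl: "k \<noteq> l" "d k l \<in> N g"
      by auto
    have not_less: "\<not> max k' l' < max m n"
      if "m \<noteq> n" "d m n \<in> N g" "d k' l' \<in> N g" for m n k' l'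
    proof
      assume "max k' l' < max m n"
      moreover have "d m n - d k' l' \<in> D"
        using that D_diff[of "d m n" "- g" "d k' l'"] by (simp add: N_def)
      ultimately show False
        using d[of m n k' l'] that by auto
    qed
    have "max m n \<le> max k l" if "m \<noteq> n" "d m n \<in> N g" for m n
      using not_less[of m n k l] kl that by auto
    then have "?A \<subseteq> {..max k l} \<times> {..max k l}"
      by force
    then show ?thesis
      by (rule finite_subset) simp
  qed
  then have "finite (\<Union>g\<in>G. {(m, n). m \<noteq> n \<and> d m n \<in> N g})"
    using G(1) by blast
  moreover have "{(m, n). m \<noteq> n \<and> d m n \<in> P} \<subseteq> (\<Union>g\<in>G. {(m, n). m \<noteq> n \<and> d m n \<in> N g})"
    using G(2) by blast
  ultimately show ?thesis
    by (rule finite_subset[rotated])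
qed

lemma finite_right_differences:
  assumes "compact P"
  shows "finite {(m, n). m \<noteq> n \<and> s m - s n \<in> P}"
proof (rule finite_pairs_in_compact[OF _ assms])
  fix m n k l :: nat
  assume *: "m \<noteq> n" "k < max m n" "l < max m n"
  show "s m - s n - (s k - s l) \<notin> D"
  proof (cases "n < m")
    case True
    then show ?thesis
      using sparse[of n m l k] * by (simp add: group_normalize del: add_uminus_conv_diff)
  next
    case False
    then have "s n - s m + s k - s l \<notin> D"
      using sparse[of m n k l] * by simp
    then have "s k - s l + (s n - s m) \<notin> D"
      using D_cyclic[of "s n - s m" "s k - s l"] by (simp add: add_diff_eq)
    moreover have "s k - s l + (s n - s m) = - (s m - s n - (s k - s l))"
      by (simp add: group_normalize del: add_uminus_conv_diff)
    ultimately show ?thesis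
      using D_uminus by metis
  qed
qed

lemma finite_left_differences:
  assumes "compact P"
  shows "finite {(m, n). m \<noteq> n \<and> - s m + s n \<in> P}"
proof (rule finite_pairs_in_compact[OF _ assms])
  fix m n k l :: nat
  assume *: "m \<noteq> n" "k < max m n" "l < max m n"
  show "- s m + s n - (- s k + s l) \<notin> D"
  proof (cases "m < n")
    case True
    then have "s n - s l + s k - s m \<notin> D"
      using sparse[of l n k m] * by simp
    then show ?thesis
      using D_cyclic[of "- s m" "s n - s l + s k"]
      by (simp add: group_normalize del: add_uminus_conv_diff)
  next
    case False
    then have "s m - s k + s l - s n \<notin> D"
      using sparse[of k m l n] * by simp
    then have "- s k + s l - s n + s m \<notin> D"
      using D_cyclic[of "s m" "- s k + s l - s n"]
      by (simp add: group_normalize del: add_uminus_conv_diff)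
    moreover have "- s k + s l - s n + s m = - (- s m + s n - (- s k + s l))"
      by (simp add: group_normalize del: add_uminus_conv_diff)
    ultimately show ?thesis
      using D_uminus by metis
  qed
qed

text \<open>
  The sum of the bumps placed at the points \<open>s n\<close>. As the bumps turn out to be disjoint, it can be
  written as a supremum, which inherits boundedness and uniform continuity without summability.
\<close>

definition F :: "'a \<Rightarrow> real" where
  "F z = (SUP n. \<psi> (- s n + z))"

lemma bdd_above_terms: "bdd_above (range (\<lambda>n. \<psi> (- s n + z)))"
  using le_M by (intro bdd_aboveI[of _ M]) auto

lemma F_upper: "\<psi> (- s n + z) \<le> F z"
  unfolding F_def using bdd_above_terms by (rule cSUP_upper[rotated]) simp

lemma F_nonneg: "F z \<ge> 0"
  using F_upper[of 0 z] nonneg[of "- s 0 + z"] by linarith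

lemma F_le_M: "F z \<le> M"
  unfolding F_def using le_M by (intro cSUP_least) auto

lemma F_eq_0: "(\<And>n. \<psi> (- s n + z) = 0) \<Longrightarrow> F z = 0"
  by (simp add: F_def)

text \<open>The summands have disjoint supports, so at most one term of the supremum is nonzero.\<close>

lemma F_eq_term:
  assumes "\<psi> (- s n + z) \<noteq> 0"
  shows "F z = \<psi> (- s n + z)"
proof -
  have "\<psi> (- s m + z) = 0" if "m \<noteq> n" for m
    using D_diff[OF _ assms, of "- s m"] differences_notin_D(2)[OF that] by auto
  then have "\<psi> (- s m + z) \<le> \<psi> (- s n + z)" for m
    using nonneg by (cases "m = n") auto
  then have "F z \<le> \<psi> (- s n + z)"
    unfolding F_def by (intro cSUP_least) auto
  with F_upper show ?thesis
    by (rule antisym[rotated])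
qed

lemma F_nonzeroE:
  assumes "F z \<noteq> 0"
  obtains n where "\<psi> (- s n + z) \<noteq> 0"
  using assms F_eq_0 by blast

text \<open>Centrality lets the small left translation pass by all the \<open>s n\<close> simultaneously.\<close>

lemma F_uniform:
  assumes "\<epsilon> > 0"
  shows "\<exists>V. open V \<and> 0 \<in> V \<and> (\<forall>v\<in>V. \<forall>z. \<bar>F (v + z) - F z\<bar> \<le> \<epsilon>)"
proof -
  obtain V where V: "open V" "0 \<in> V" "\<And>v z. v \<in> V \<Longrightarrow> \<bar>\<psi> (v + z) - \<psi> z\<bar> \<le> \<epsilon>"
    using uniform[OF assms] by blast
  have "\<bar>F (v + z) - F z\<bar> \<le> \<epsilon>" if v: "v \<in> V" for v z
  proof -
    have *: "\<bar>\<psi> (- s n + (v + z)) - \<psi> (- s n + z)\<bar> \<le> \<epsilon>" for n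
      using V(3)[OF v, of "z - s n"] central[of "- s n" "v + z"] central[of "- s n" z]
      by (simp add: add_diff_eq)
    have "F (v + z) \<le> F z + \<epsilon>"
      unfolding F_def[of "v + z"]
    proof (rule cSUP_least)
      show "\<psi> (- s n + (v + z)) \<le> F z + \<epsilon>" for n
        using *[of n] F_upper[of n z] by linarith
    qed simp
    moreover have "F z \<le> F (v + z) + \<epsilon>"
      unfolding F_def[of z]
    proof (rule cSUP_least)
      show "\<psi> (- s n + z) \<le> F (v + z) + \<epsilon>" for n
        using *[of n] F_upper[of n "v + z"] by linarith
    qed simp
    ultimately show ?thesis
      by linarith
  qed
  with V(1,2) show ?thesis
    by blast
qed

definition bump_sum :: "'a \<Rightarrow>\<^sub>C complex" where
  "bump_sum = Bcontfun (\<lambda>z. complex_of_real (F z))"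

lemma apply_bump_sum [simp]: "apply_bcontfun bump_sum z = complex_of_real (F z)"
proof -
  have "continuous_on UNIV F"
    using F_uniform by (intro left_uniformly_continuous_imp_continuous) (auto simp: dist_real_def)
  then have "(\<lambda>z. complex_of_real (F z)) \<in> bcontfun"
    using F_nonneg F_le_M by (intro bcontfun_normI[where b = M] continuous_intros) auto
  then show ?thesis
    unfolding bump_sum_def by (simp add: Bcontfun_inverse)
qed

text \<open>
  If the bumps with indices \<open>m\<close> and \<open>n\<close> of two left translates meet, then \<open>x - x'\<close> lies in
  \<open>s m + D - s n = s m - s n + D\<close>; by sparsity this leaves finitely many pairs.
\<close>

lemma translates_overlap_in_compact:
  assumes x: "x - x' \<notin> (\<lambda>(a, b). a - b) ` (K \<times> K)"
  shows "\<exists>P. compact P \<and> {z. F (x + z) \<noteq> 0 \<and> F (x' + z) \<noteq> 0} \<subseteq> P"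
proof -
  let ?KK = "(\<lambda>(a, b). a - b) ` (K \<times> K)"
  define I where "I = {(n, m). n \<noteq> m \<and> s n - s m \<in> (+) (- (x - x')) ` ?KK}"
  have "finite I"
    unfolding I_def
    by (intro finite_right_differences compact_image_left_add compact_image_diff compact_K)
  define P where "P = (\<Union>(n, m)\<in>I. (+) (- x' + s n) ` K)"
  have "compact P"
    unfolding P_def using \<open>finite I\<close> compact_image_left_add[OF compact_K] by (intro compact_UN) auto
  moreover have "z \<in> P" if z: "F (x + z) \<noteq> 0" "F (x' + z) \<noteq> 0" for z
  proof -
    obtain m n where mn: "\<psi> (- s m + (x + z)) \<noteq> 0" "\<psi> (- s n + (x' + z)) \<noteq> 0"
      using z by (metis F_nonzeroE)
    then have "(- s m + x) - (- s n + x') \<in> D"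
      using D_diff[of "- s m + x" z "- s n + x'"] by (simp add: add.assoc)
    then have "- s m + (x - x' + s n) \<in> D"
      by (simp add: group_normalize del: add_uminus_conv_diff)
    then have "(x - x') + (s n - s m) \<in> D"
      using D_cyclic[of "- s m" "x - x' + s n"] by (simp add: group_normalize del: add_uminus_conv_diff)
    then have d: "(x - x') + (s n - s m) \<in> ?KK"
      using D_subset by blast
    have "n \<noteq> m"
      using d x by auto
    moreover have "s n - s m \<in> (+) (- (x - x')) ` ?KK"
      using d by (intro image_eqI[of _ _ "(x - x') + (s n - s m)"])
        (simp_all add: group_normalize del: add_uminus_conv_diff)
    ultimately have "(n, m) \<in> I"
      by (simp add: I_def)
    moreover have "z \<in> (+) (- x' + s n) ` K"
      using support[OF mn(2)] by (intro image_eqI[of _ _ "- s n + (x' + z)"])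
        (simp_all add: group_normalize del: add_uminus_conv_diff)
    ultimately show ?thesis
      unfolding P_def by blast
  qed
  ultimately show ?thesis
    by blast
qed

text \<open>
  Outside a compact set of \<open>x\<close>, the left translate by \<open>x\<close> is weakly close to zero or to a single
  translated bump. Either the exceptional translates eventually vanish on every compact set, or
  there is a compact set which infinitely many of them meet in one bump. In the second case this
  bump is subtracted, and the remainder again escapes from every compact set, because \<open>- s m + s n\<close>
  tends to infinity as the larger of two distinct indices grows. Such escaping functions with
  relatively compact overlaps cannot all be detected by finitely many functionals.
\<close>

lemma translates_enter_neighbourhoods_of_bump_translates:
  assumes W: "openin weak_topology_bcontfun W" "bump_translates \<subseteq> W"
  shows "\<exists>C. compact C \<and> (\<forall>x. x \<notin> C \<longrightarrow> left_translate x bump_sum \<in> W)"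
proof (rule ccontr)
  assume "\<not> ?thesis"
  then have far: "\<exists>x. x \<notin> C \<and> left_translate x bump_sum \<notin> W" if "compact C" for C
    using that by blast
  obtain \<Phi> \<epsilon> where \<Phi>: "finite \<Phi>" "\<Phi> \<subseteq> dual_bcontfun" "\<epsilon> > 0"
      "\<And>b f. b \<in> bump_translates \<Longrightarrow> (\<And>\<phi>. \<phi> \<in> \<Phi> \<Longrightarrow> norm (\<phi> (f - b)) < \<epsilon>) \<Longrightarrow> f \<in> W"
    using weakly_compact_uniform_neighbourhood[OF weakly_compact_bump_translates W] by metis
  \<comment> \<open>the remainders of the exceptional translates, for both cases of the argument\<close>
  define Rem where "Rem x r \<longleftrightarrow> left_translate x bump_sum \<notin> W \<and>
      (\<exists>b\<in>bump_translates. r = left_translate x bump_sum - b) \<and>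
      (\<forall>z. apply_bcontfun r z \<noteq> 0 \<longrightarrow> apply_bcontfun r z = complex_of_real (F (x + z)))" for x r
  have no_escape: False
    if escape: "\<And>C P. compact C \<Longrightarrow> compact P \<Longrightarrow>
        \<exists>x r. Rem x r \<and> x \<notin> C \<and> (\<forall>z\<in>P. apply_bcontfun r z = 0)"
  proof (rule no_thinly_overlapping_family[OF \<Phi>(1,2,3), of "{r. \<exists>x. Rem x r}" M])
    fix r z
    assume "r \<in> {r. \<exists>x. Rem x r}"
    then obtain x where "Rem x r"
      by blast
    then have "apply_bcontfun r z = 0 \<or> apply_bcontfun r z = complex_of_real (F (x + z))"
      unfolding Rem_def by blast
    then show "norm (apply_bcontfun r z) \<le> M"
      using M_nonneg F_nonneg F_le_M by auto
  next
    fix r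
    assume "r \<in> {r. \<exists>x. Rem x r}"
    then obtain x b where "left_translate x bump_sum \<notin> W" "b \<in> bump_translates"
        "r = left_translate x bump_sum - b"
      unfolding Rem_def by blast
    then obtain \<phi> where "\<phi> \<in> \<Phi>" "norm (\<phi> r) \<ge> \<epsilon>"
      using \<Phi>(4)[of b "left_translate x bump_sum"] by force
    then show "\<epsilon> \<le> (\<Sum>\<phi>\<in>\<Phi>. norm (\<phi> r))"
      using member_le_sum[of \<phi> \<Phi> "\<lambda>\<phi>. norm (\<phi> r)"] \<Phi>(1) by auto
  next
    fix H P
    assume H: "finite H" "H \<subseteq> {r. \<exists>x. Rem x r}" and P: "compact (P :: 'a set)"
    then have "\<forall>h\<in>H. \<exists>x. Rem x h"
      by blast
    then obtain y where y: "\<And>h. h \<in> H \<Longrightarrow> Rem (y h) h"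
      by (elim bchoice[elim_format] exE) blast
    let ?KK = "(\<lambda>(a, b). a - b) ` (K \<times> K)"
    define C where "C = (\<Union>h\<in>H. (\<lambda>d. d + y h) ` ?KK)"
    have "compact C"
      unfolding C_def using H(1)
      by (intro compact_UN compact_continuous_image compact_image_diff compact_K continuous_intros)
    from escape[OF this P]
    obtain x r where xr: "Rem x r" "x \<notin> C" "\<And>z. z \<in> P \<Longrightarrow> apply_bcontfun r z = 0"
      by (elim exE conjE) simp
    have "\<exists>P'. compact P' \<and> {z. apply_bcontfun r z \<noteq> 0 \<and> apply_bcontfun h z \<noteq> 0} \<subseteq> P'"
      if h: "h \<in> H" for h
    proof -
      have "x - y h \<notin> ?KK"
      proof
        assume "x - y h \<in> ?KK"
        then have "x \<in> (\<lambda>d. d + y h) ` ?KK"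
          by (rule rev_image_eqI) simp
        with h xr(2) show False
          by (auto simp: C_def)
      qed
      from translates_overlap_in_compact[OF this]
      obtain P' where P': "compact P'" "{z. F (x + z) \<noteq> 0 \<and> F (y h + z) \<noteq> 0} \<subseteq> P'"
        by (elim exE conjE)
      have nz: "F (x' + z) \<noteq> 0" if "Rem x' r'" "apply_bcontfun r' z \<noteq> 0" for x' r' z
      proof
        assume "F (x' + z) = 0"
        moreover have "apply_bcontfun r' z = complex_of_real (F (x' + z))"
          using that unfolding Rem_def by (elim conjE allE[of _ z]) simp
        ultimately show False
          using that(2) by simp
      qed
      have "{z. apply_bcontfun r z \<noteq> 0 \<and> apply_bcontfun h z \<noteq> 0} \<subseteq> {z. F (x + z) \<noteq> 0 \<and> F (y h + z) \<noteq> 0}"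
        using nz[OF xr(1)] nz[OF y[OF h]] by (intro Collect_mono) simp
      also note P'(2)
      finally show ?thesis
        by (intro exI[of _ P'] conjI P'(1))
    qed
    then show "\<exists>r\<in>{r. \<exists>x. Rem x r}. (\<forall>z\<in>P. apply_bcontfun r z = 0) \<and>
        (\<forall>h\<in>H. \<exists>P'. compact P' \<and> {z. apply_bcontfun r z \<noteq> 0 \<and> apply_bcontfun h z \<noteq> 0} \<subseteq> P')"
      using xr(1,3) by (intro bexI[of _ r] conjI ballI CollectI exI[of _ x]) simp_all
  qed (rule M_nonneg)
  define meets where "meets P \<longleftrightarrow> (\<forall>C. compact C \<longrightarrow>
      (\<exists>x. x \<notin> C \<and> left_translate x bump_sum \<notin> W \<and> (\<exists>z\<in>P. F (x + z) \<noteq> 0)))" for P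
  show False
  proof (cases "\<exists>P. compact P \<and> meets P")
    case False
    show ?thesis
    proof (rule no_escape)
      fix C P
      assume C: "compact (C :: 'a set)" and P: "compact (P :: 'a set)"
      have "\<not> meets P"
        using False P by simp
      then obtain C' where C': "compact C'"
          "\<not> (\<exists>x. x \<notin> C' \<and> left_translate x bump_sum \<notin> W \<and> (\<exists>z\<in>P. F (x + z) \<noteq> 0))"
        unfolding meets_def not_all not_imp by (elim exE conjE)
      obtain x where x: "x \<notin> C \<union> C'" "left_translate x bump_sum \<notin> W"
        using far[OF compact_Un[OF C C'(1)]] by (elim exE conjE)
      have "F (x + z) = 0" if "z \<in> P" for z
        using C'(2) x that by auto
      moreover have "Rem x (left_translate x bump_sum)"
        using x(2) unfolding Rem_def bump_translates_def
        by (intro conjI bexI[of _ 0]) (simp_all add: left_translate.rep_eq)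
      ultimately show "\<exists>x r. Rem x r \<and> x \<notin> C \<and> (\<forall>z\<in>P. apply_bcontfun r z = 0)"
        using x(1) by (intro exI[of _ x] exI[of _ "left_translate x bump_sum"])
          (simp add: left_translate.rep_eq)
    qed
  next
    case True
    then obtain P where P: "compact P" "meets P"
      by (elim exE conjE)
    let ?dif = "\<lambda>A B. (\<lambda>(a, b). a - b) ` (A \<times> B) :: 'a set"
    show ?thesis
    proof (rule no_escape)
      fix C P2
      assume C: "compact (C :: 'a set)" and P2: "compact (P2 :: 'a set)"
      define I where "I = {(m, n). m \<noteq> n \<and> - s m + s n \<in> ?dif (?dif K P2) (?dif K P)}"
      have "finite I"
        unfolding I_def by (intro finite_left_differences compact_image_diff compact_K P(1) P2)
      define C' where "C' = C \<union> (\<Union>(m, n)\<in>I. (+) (s n) ` ?dif K P)"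
      have "compact (\<Union>(m, n)\<in>I. (+) (s n) ` ?dif K P)"
        using \<open>finite I\<close> compact_image_left_add[OF compact_image_diff[OF compact_K P(1)]]
        by (intro compact_UN) auto
      then have "compact C'"
        unfolding C'_def by (rule compact_Un[OF C])
      then obtain x z where x: "x \<notin> C'" "left_translate x bump_sum \<notin> W" "z \<in> P" "F (x + z) \<noteq> 0"
        using P(2) unfolding meets_def by (elim allE impE exE conjE bexE)
      obtain n where n: "\<psi> (- s n + (x + z)) \<noteq> 0"
        using x(4) by (rule F_nonzeroE)
      have xn: "- s n + x \<in> ?dif K P"
        using support[OF n] x(3) by (intro image_eqI[of _ _ "(- s n + (x + z), z)"])
          (simp_all add: group_normalize del: add_uminus_conv_diff)
      define r where "r = left_translate x bump_sum - left_translate (- s n + x) bump"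
      have r: "apply_bcontfun r w = complex_of_real (F (x + w) - \<psi> (- s n + (x + w)))" for w
        by (simp add: r_def left_translate.rep_eq add.assoc)
      have rz: "apply_bcontfun r w = (if \<psi> (- s n + (x + w)) = 0 then complex_of_real (F (x + w)) else 0)" for w
        using F_eq_term[of n "x + w"] by (simp add: r)
      have "Rem x r"
        unfolding Rem_def using x(2) rz by (auto simp: r_def bump_translates_def)
      moreover have "apply_bcontfun r w = 0" if w: "w \<in> P2" for w
      proof (rule ccontr)
        assume "apply_bcontfun r w \<noteq> 0"
        then have w0: "\<psi> (- s n + (x + w)) = 0" "F (x + w) \<noteq> 0"
          by (auto simp: rz split: if_splits)
        obtain m where m: "\<psi> (- s m + (x + w)) \<noteq> 0"
          using w0(2) by (rule F_nonzeroE)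
        have "- s m + x \<in> ?dif K P2"
          using support[OF m] w by (intro image_eqI[of _ _ "(- s m + (x + w), w)"])
            (simp_all add: group_normalize del: add_uminus_conv_diff)
        then have "- s m + s n \<in> ?dif (?dif K P2) (?dif K P)"
          using xn by (intro image_eqI[of _ _ "(- s m + x, - s n + x)"])
            (simp_all add: group_normalize del: add_uminus_conv_diff)
        moreover have "m \<noteq> n"
          using m w0(1) by auto
        ultimately have "(m, n) \<in> I"
          by (simp add: I_def)
        moreover have "x \<in> (+) (s n) ` ?dif K P"
          using xn by (intro image_eqI[of _ _ "- s n + x"]) simp_all
        ultimately have "x \<in> (\<Union>(m, n)\<in>I. (+) (s n) ` ?dif K P)"
          by (intro UN_I[of "(m, n)"]) simp_all
        then have "x \<in> C'"
          by (simp add: C'_def)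
        with x(1) show False
          by simp
      qed
      moreover have "x \<notin> C"
        using x(1) by (simp add: C'_def)
      ultimately show "\<exists>x r. Rem x r \<and> x \<notin> C \<and> (\<forall>z\<in>P2. apply_bcontfun r z = 0)"
        by (intro exI[of _ x] exI[of _ r]) simp
    qed
  qed
qed

lemma bump_sum_in_WAP: "bump_sum \<in> WAP"
proof -
  have "compactin weak_topology_bcontfun (bump_translates \<union> range (\<lambda>x. left_translate x bump_sum))"
  proof (rule weakly_compact_adjoin_family[OF weakly_compact_bump_translates])
    show "continuous_on UNIV (\<lambda>x. left_translate x bump_sum)"
      using F_uniform by (intro continuous_left_translate)
        (simp add: dist_norm del: of_real_diff add: of_real_diff[symmetric])
  qed (rule translates_enter_neighbourhoods_of_bump_translates)
  then show ?thesis
    unfolding WAP_def left_orbit_def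
    by (auto intro!: relatively_weakly_compactI)
qed

lemma eventually_s_notin_compact:
  assumes "compact P"
  shows "\<forall>\<^sub>F k in sequentially. s k \<notin> P"
proof -
  have "finite {(m, n). m \<noteq> n \<and> - s m + s n \<in> (+) (- s 0) ` P}"
    by (intro finite_left_differences compact_image_left_add assms)
  then have "finite (snd ` {(m, n). m \<noteq> n \<and> - s m + s n \<in> (+) (- s 0) ` P})"
    by (rule finite_imageI)
  moreover have "{k. s k \<in> P} \<subseteq> insert 0 (snd ` {(m, n). m \<noteq> n \<and> - s m + s n \<in> (+) (- s 0) ` P})"
  proof
    fix k
    assume "k \<in> {k. s k \<in> P}"
    then show "k \<in> insert 0 (snd ` {(m, n). m \<noteq> n \<and> - s m + s n \<in> (+) (- s 0) ` P})"
      by (cases "k = 0") (auto intro!: image_eqI[of _ snd "(0, k)"])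
  qed
  ultimately have "finite {k. s k \<in> P}"
    using finite_subset by blast
  then show ?thesis
    by (simp add: eventually_cofinite[symmetric] cofinite_eq_sequentially[symmetric] eventually_cofinite)
qed

text \<open>
  Suppose the sum is \<open>g + h\<close>. By almost periodicity two different \<open>s n\<close> and \<open>s m\<close> give nearly the
  same left translate of \<open>g\<close>, so \<open>g\<close> takes nearly the same value at \<open>s k\<close> and at
  \<open>s m - s n + s k\<close>. For large \<open>k\<close> the function \<open>h\<close> is negligible at both points, but the sum of
  bumps is \<open>\<psi> 0\<close> at the first and, by sparsity, zero at the second.
\<close>

lemma bump_sum_notin_AP_plus_C0:
  assumes g: "g \<in> AP" and h: "h \<in> C0"
  shows "bump_sum \<noteq> g + h"
proof
  assume eq: "bump_sum = g + h"
  define \<epsilon> where "\<epsilon> = \<psi> 0 / 4"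
  have "\<epsilon> > 0"
    using pos_0 by (simp add: \<epsilon>_def)
  obtain I where I: "finite I"
      "\<And>x. \<exists>i\<in>I. \<forall>z. dist (apply_bcontfun g (x + z)) (apply_bcontfun g (i + z)) < \<epsilon> / 2"
    using AP_finite_net[OF g, of "\<epsilon> / 2"] \<open>\<epsilon> > 0\<close> by auto
  then obtain \<iota> where \<iota>: "\<And>x. \<iota> x \<in> I"
      "\<And>x z. dist (apply_bcontfun g (x + z)) (apply_bcontfun g (\<iota> x + z)) < \<epsilon> / 2"
    by metis
  have "\<not> inj (\<lambda>n. \<iota> (s n))"
    using I(1) \<iota>(1) finite_subset[of "range (\<lambda>n. \<iota> (s n))" I] range_inj_infinite by blast
  then obtain m n where mn: "m \<noteq> n" "\<iota> (s m) = \<iota> (s n)"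
    by (auto simp: inj_def)
  have near: "dist (apply_bcontfun g (s n + z)) (apply_bcontfun g (s m + z)) < \<epsilon>" for z
    using \<iota>(2)[of "s n" z] \<iota>(2)[of "s m" z] mn(2) dist_triangle_half_l by metis
  obtain L where L: "compact L" "\<And>z. z \<notin> L \<Longrightarrow> norm (apply_bcontfun h z) < \<epsilon>"
    using h \<open>\<epsilon> > 0\<close> unfolding C0_def by blast
  have "\<forall>\<^sub>F k in sequentially. s k \<notin> L \<and> s k \<notin> (+) (- (s m - s n)) ` L \<and> k > max m n"
    using L(1) by (intro eventually_conj eventually_s_notin_compact compact_image_left_add
        eventually_gt_at_top)
  then obtain k where k: "s k \<notin> L" "s k \<notin> (+) (- (s m - s n)) ` L" "k > max m n"
    using eventually_happens trivial_limit_sequentially by blast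
  have "s m - s n + s k \<notin> L"
  proof
    assume "s m - s n + s k \<in> L"
    then have "s k \<in> (+) (- (s m - s n)) ` L"
      by (rule rev_image_eqI) (simp add: group_normalize del: add_uminus_conv_diff)
    with k(2) show False
      by simp
  qed
  moreover have "F (s k) = \<psi> 0"
    using F_eq_term[of k "s k"] pos_0 by simp
  moreover have "F (s m - s n + s k) = 0"
  proof (rule F_eq_0)
    fix j
    show "\<psi> (- s j + (s m - s n + s k)) = 0"
    proof (rule ccontr)
      assume "\<psi> (- s j + (s m - s n + s k)) \<noteq> 0"
      then have "- s j + (s m - s n + s k) - 0 \<in> D"
        using pos_0 by (intro D_I) simp_all
      then have inD: "s m - s n + s k - s j \<in> D"
        using D_cyclic[of "- s j" "s m - s n + s k"] by simp
      consider "j < k" | "j = k" | "k < j"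
        by linarith
      then show False
      proof cases
        case 1
        have "s k - s j + s m - s n \<in> D"
          using inD D_cyclic[of "s m - s n" "s k - s j"]
          by (simp add: group_normalize del: add_uminus_conv_diff)
        then show False
          using sparse[of j k m n] 1 k(3) by simp
      next
        case 2
        then show False
          using inD differences_notin_D(1)[OF mn(1)]
          by (simp add: group_normalize del: add_uminus_conv_diff)
      next
        case 3
        have "s j - s k + s n - s m \<in> D"
          using D_uminus[OF inD] by (simp add: group_normalize del: add_uminus_conv_diff)
        then show False
          using sparse[of k j n m] 3 k(3) by simp
      qed
    qed
  qed
  moreover have "apply_bcontfun g z = complex_of_real (F z) - apply_bcontfun h z" for z
    using eq by (metis add_diff_cancel_right' apply_bump_sum plus_bcontfun.rep_eq)
  ultimately have
    "norm (complex_of_real (\<psi> 0) - apply_bcontfun h (s k) + apply_bcontfun h (s m - s n + s k)) < \<epsilon>"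
    using near[of "- s n + s k"]
    by (simp add: dist_norm group_normalize del: add_uminus_conv_diff)
  moreover have "norm (apply_bcontfun h (s k)) < \<epsilon>" "norm (apply_bcontfun h (s m - s n + s k)) < \<epsilon>"
    using L(2) k(1) \<open>s m - s n + s k \<notin> L\<close> by auto
  moreover have "norm (complex_of_real (\<psi> 0)) = 4 * \<epsilon>"
    using pos_0 by (simp add: \<epsilon>_def)
  ultimately show False
    using \<open>\<epsilon> > 0\<close> norm_triangle_ineq4[of "complex_of_real (\<psi> 0) - apply_bcontfun h (s k) + apply_bcontfun h (s m - s n + s k)"
        "apply_bcontfun h (s m - s n + s k) - apply_bcontfun h (s k)"]
      norm_triangle_ineq4[of "apply_bcontfun h (s m - s n + s k)" "apply_bcontfun h (s k)"]
    by (simp add: algebra_simps)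
qed

end

section \<open>The theorem\<close>

lemma C0_two_sided_uniformly_continuous_eq_0:
  fixes h :: "'a::{topological_group_add, t2_space} \<Rightarrow>\<^sub>C complex"
  assumes noncompact: "\<not> compact (UNIV :: 'a set)"
    and WAP: "(WAP :: ('a \<Rightarrow>\<^sub>C complex) set) \<subseteq> {g + h | g h. g \<in> AP \<and> h \<in> C0}"
    and h: "h \<in> C0" "two_sided_uniformly_continuous (apply_bcontfun h)"
  shows "h = 0"
proof (rule ccontr)
  assume "h \<noteq> 0"
  then obtain \<psi> K M where "central_bump (\<psi> :: 'a \<Rightarrow> real) K M"
    using central_bump_exists[OF h] by blast
  then interpret central_bump \<psi> K M .
  obtain s :: "nat \<Rightarrow> 'a" where "\<forall>N. \<forall>i<N. \<forall>j<N. \<forall>k<N. s N - s i + s j - s k \<notin> D"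
    using sparse_sequence_exists[OF noncompact] by blast
  then interpret sparse_bumps \<psi> K M s
    by unfold_locales blast
  show False
    using bump_sum_in_WAP bump_sum_notin_AP_plus_C0 WAP by blast
qed

lemma two_sided_uniformly_continuous_diff:
  fixes f g :: "'a::topological_group_add \<Rightarrow> 'b::real_normed_vector"
  assumes f: "two_sided_uniformly_continuous f" and g: "two_sided_uniformly_continuous g"
  shows "two_sided_uniformly_continuous (\<lambda>z. f z - g z)"
  unfolding two_sided_uniformly_continuous_def
proof (intro allI impI)
  fix \<epsilon> :: real
  assume "\<epsilon> > 0"
  obtain U where U: "open U" "0 \<in> U" "\<And>v x y. v \<in> U \<Longrightarrow> dist (f (x + v + y)) (f (x + y)) \<le> \<epsilon> / 2"
    using f \<open>\<epsilon> > 0\<close> unfolding two_sided_uniformly_continuous_def by (meson half_gt_zero)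
  obtain V where V: "open V" "0 \<in> V" "\<And>v x y. v \<in> V \<Longrightarrow> dist (g (x + v + y)) (g (x + y)) \<le> \<epsilon> / 2"
    using g \<open>\<epsilon> > 0\<close> unfolding two_sided_uniformly_continuous_def by (meson half_gt_zero)
  have "dist (f (x + v + y) - g (x + v + y)) (f (x + y) - g (x + y)) \<le> \<epsilon>" if "v \<in> U \<inter> V" for v x y
    using U(3)[of v x y] V(3)[of v x y] that
      norm_triangle_ineq4[of "f (x + v + y) - f (x + y)" "g (x + v + y) - g (x + y)"]
    by (simp add: dist_norm algebra_simps)
  then show "\<exists>V. open V \<and> 0 \<in> V \<and>
      (\<forall>v\<in>V. \<forall>x y. dist (f (x + v + y) - g (x + v + y)) (f (x + y) - g (x + y)) \<le> \<epsilon>)"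
    using U V by (intro exI[of _ "U \<inter> V"]) auto
qed

theorem theorem3p3:
  assumes "locally_compact_space (euclidean :: 'a::{topological_group_add, t2_space} topology)"
    and "\<not> compact (UNIV :: 'a set)"
    and "minimally_weakly_almost_periodic TYPE('a)"
  shows "(WS :: ('a \<Rightarrow>\<^sub>C complex) set) = AP"
proof
  show "(AP :: ('a \<Rightarrow>\<^sub>C complex) set) \<subseteq> WS"
    using AP_subset_WS by blast
next
  have WAP: "(WAP :: ('a \<Rightarrow>\<^sub>C complex) set) = {g + h | g h. g \<in> AP \<and> h \<in> C0}"
    using assms(3) by (simp add: minimally_weakly_almost_periodic_def)
  show "(WS :: ('a \<Rightarrow>\<^sub>C complex) set) \<subseteq> AP"
  proof
    fix f :: "'a \<Rightarrow>\<^sub>C complex"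
    assume f: "f \<in> WS"
    then obtain g h where gh: "f = g + h" "g \<in> AP" "h \<in> C0"
      using WS_subset_WAP WAP by blast
    have "two_sided_uniformly_continuous (\<lambda>z. apply_bcontfun f z - apply_bcontfun g z)"
      by (intro two_sided_uniformly_continuous_diff WS_imp_two_sided_uniformly_continuous
          assms(1) f AP_subset_WS gh(2))
    then have "two_sided_uniformly_continuous (apply_bcontfun h)"
      by (simp add: gh(1))
    then have "h = 0"
      using C0_two_sided_uniformly_continuous_eq_0[OF assms(2)] WAP gh(3) by blast
    then show "f \<in> AP"
      using gh by simp
  qed
qed

end
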